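(* Let $X\subset\mathbb{R}^d$ be a general dataset of $n$ points, i.e. every stationary point $C^*\in\{C^*\}_{[k]}$ has a $\delta'$-margin with respect to $X$ for some $\delta'>0$. Fix any $0<\delta<\frac1e$. Run the stochastic $k$-means algorithm on $X$ with an arbitrary initial set of $k$ centroids $C^0\subset \mathrm{conv}(X)$, any mini-batch size $m\ge 1$, and learning rate $\eta_r^t=\eta^t=\frac{c'}{t+t_o}$ for all $r\in[k]$, where $$c'>\max\Big\{\frac{\phi_{\max}}{(1-e^{-m/n})\,r_{\min}\,\phi_{opt}},\ \frac{1}{1-e^{-\frac{4m}{5n}}}\Big\},\qquad t_o\ge 768\,(c')^2\Big(1+\frac1{r_{\min}}\Big)^2n^2\ln^2\frac1\delta .$$ Then there exist events $G(A^* )$, one for each stationary clustering $A^*\in\{A^*\}_{[k]}$, such that $$\Pr\Big\{\bigcup_{A^*\in\{A^*\}_{[k]}}G(A^* )\Big\}\ge 1-\delta,$$ and for every stationary clustering $A^*$, writing $\phi^t=\phi(C^t)$ and $\phi^*=\phi(m(A^* ))$, we have for all $t\ge 0$ $$E\{\phi^t-\phi^*\mid G(A^* )\}=O\Big(\frac1t\Big).$$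
   Context: **$k$-means.** $X\subset\mathbb{R}^d$ is a finite dataset with $|X|=n$. For a set of centroids $C=\{c_1,\dots,c_k\}\subset\mathbb{R}^d$, $\phi(C)=\sum_{x\in X}\min_r\|x-c_r\|^2$. $V(C)\cap X$ denotes the set of all clusterings $A=\{A_r\}$ of $X$ obtained by assigning each $x\in X$ to one of its closest centroids in $C$ (ties broken arbitrarily). A centroid whose cluster is empty is called degenerate; degenerate centroids are ignored in comparisons. For a clustering $A$ with nonempty clusters, $m(A)=\{m(A_r)\}$ is the set of means of its clusters. $\mathrm{conv}(X)$ is the convex hull. $\phi_{\max}$ is the largest $k$-means cost on $X$ (over sets of $k$ centroids in $\mathrm{conv}(X)$), and $\phi_{opt}$ is the smallest $k$-means cost; costs are assumed positive ($\phi_{opt}>0$). **Stationary solutions.** $\{A\}_{[k]}$ is the set of all clusterings of $X$ into $k'$ nonempty clusters, $1\le k'\le k$. $A^*\in\{A\}_{[k]}$ is a stationary clustering if $A^*\in V(m(A^* ))\cap X$; then $C^*=m(A^* )$ is the corresponding stationary point. $\{A^*\}_{[k]}$ and $\{C^*\}_{[k]}$ denote the sets of all stationary clusterings and stationary points. **Margin.** For $A\in V(C)\cap X$, $r\neq s$ and $x\in A_r\cup A_s$, let $\bar x$ be the projection of $x$ onto the line through $c_r,c_s$, and $\Delta_{rs}(C)=\min_{x\in A_r\cup A_s}\big|\|\bar x-c_r\|-\|\bar x-c_s\|\big|$. $V(C)$ (or $C$) has a $\delta$-margin with respect to $X$ if for some $A\in V(C)\cap X$, $\min_{r,\,s\ne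 r}\Delta_{rs}(C)=\delta$ (a minimum over an empty set is $+\infty$). **Distances and stability.** Let $C=m(A)$ with $A$ having $k_0$ nonempty clusters, $n_r=|A_r|$, and let $C'$ be a set of at least $k_0$ centroids with exactly $k_0$ non-degenerate ones. $\Delta(C',C)=\min_{\pi}\sum_r n_r\|c'_{\pi(r)}-c_r\|^2$, the minimum over bijections $\pi$ from the indices of $C$ to the indices of the non-degenerate centroids of $C'$. If $A'\in V(C')\cap X$, the clustering distance is $\mathrm{ClustDist}=\max_r |A'_{\pi(r)}\triangle A_r|/n_r$ with $\pi$ attaining $\Delta(C',C)$. A stationary point $C^*=m(A^* )$ is $(b_0,0)$-stable if $\mathrm{ClustDist}$ between the clustering induced by $C$ and $A^*$ is $0$ whenever $\Delta(C,C^* )\le b_0\,\phi(C^* )$. **The constant $r_{\min}$.** For a general dataset $X$, $r_{\min}>0$ is a constant (one always exists) such that (1) every $C^*\in\{C^*\}_{[k]}$ is $(r_{\min},0)$-stable; (2) whenever $m(A')\notin\{C^*\}_{[k]}$ and $A'\in V(C')\cap X$, $\Delta(C',m(A'))\ge r_{\min}\,\phi(m(A'))$. **Stochastic $k$-means algorithm.** Input: $X$, $k$, mini-batch size $m$, learning rates $\eta_r^t$, initial $C^0=\{c^0_1,\dots,c^0_k\}$. At iteration $t\ge1$: draw a sample $S^t$ of $m$ points of $X$ uniformly at random with replacement; assign each $s\in S^t$ to a closest centroid in $C^{t-1}$, giving sub-samples $S^t_r$; for each $r$ with $S_r^t\ne\emptyset$, set $c_r^t=(1-\eta_r^t)c_r^{t-1}+\eta_r^t\hat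 c_r^t$ with $\hat c_r^t$ the mean of $S_r^t$; for other $r$, $c_r^t=c_r^{t-1}$. $O(1/t)$ means bounded by a constant times $1/t$, the constant not depending on $t$; conditional expectations are understood for events of positive probability. *)

theory Defs
  imports "HOL-Probability.Probability"
begin

text \<open>
  A set of centroids is a finite set of points. Clusterings are unlabelled: a clustering of \<open>X\<close>
  is a partition of \<open>X\<close> into nonempty clusters, so that empty clusters (those of degenerate
  centroids) never occur in it.
\<close>

definition kcost :: "'a::euclidean_space set \<Rightarrow> 'a set \<Rightarrow> real" where
  "kcost X C = (\<Sum>x\<in>X. Min ((\<lambda>c. (norm (x - c))\<^sup>2) ` C))"

definition phi_max :: "'a::euclidean_space set \<Rightarrow> nat \<Rightarrow> real" where
  "phi_max X k = Sup {kcost X C | C. card C = k \<and> C \<subseteq> convex hull X}"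

definition phi_opt :: "'a::euclidean_space set \<Rightarrow> nat \<Rightarrow> real" where
  "phi_opt X k = Inf {kcost X C | C. finite C \<and> card C = k}"

text \<open>
  \<open>nearest X I c f\<close>: the map \<open>f\<close> sends every data point to (the index of) one of its closest
  centroids in the family \<open>c\<close> indexed by \<open>I\<close>, ties being broken arbitrarily. A set \<open>C\<close> of
  centroids is indexed by itself, i.e. \<open>I = C\<close> and \<open>c = id\<close>; the non-degenerate centroids are
  then the elements of \<open>f ` X\<close>.
\<close>

definition nearest :: "'a::euclidean_space set \<Rightarrow> 'i set \<Rightarrow> ('i \<Rightarrow> 'a) \<Rightarrow> ('a \<Rightarrow> 'i) \<Rightarrow> bool" where
  "nearest X I c f \<longleftrightarrow>
     (\<forall>x\<in>X. f x \<in> I \<and> (\<forall>s\<in>I. norm (x - c (f x)) \<le> norm (x - c s)))"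

definition cluster :: "'a set \<Rightarrow> ('a \<Rightarrow> 'i) \<Rightarrow> 'i \<Rightarrow> 'a set" where
  "cluster X f r = {x \<in> X. f x = r}"

definition induced :: "'a set \<Rightarrow> ('a \<Rightarrow> 'i) \<Rightarrow> 'a set set" where
  "induced X f = cluster X f ` (f ` X)"

text \<open>The clusterings that are written \<open>V(C) \<inter> X\<close> in the literature.\<close>

definition voronoi :: "'a::euclidean_space set \<Rightarrow> 'a set \<Rightarrow> 'a set set set" where
  "voronoi X C = {induced X f | f. nearest X C id f}"

definition mean :: "'a::euclidean_space set \<Rightarrow> 'a" where
  "mean P = (\<Sum>x\<in>P. x) /\<^sub>R real (card P)"

definition means :: "'a::euclidean_space set set \<Rightarrow> 'a set" where
  "means A = mean ` A"

definition clusterings :: "'a set \<Rightarrow> nat \<Rightarrow> 'a set set set" where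
  "clusterings X k = {A. partition_on X A \<and> 1 \<le> card A \<and> card A \<le> k}"

definition stationary_clusterings :: "'a::euclidean_space set \<Rightarrow> nat \<Rightarrow> 'a set set set" where
  "stationary_clusterings X k = {A \<in> clusterings X k. A \<in> voronoi X (means A)}"

definition stationary_points :: "'a::euclidean_space set \<Rightarrow> nat \<Rightarrow> 'a set set" where
  "stationary_points X k = means ` stationary_clusterings X k"

text \<open>
  Margins are extended reals, so that a minimum over the empty set is \<open>\<infinity>\<close>; for finite \<open>X\<close> and
  \<open>C\<close> the infima below are minima.
\<close>

definition pair_margin :: "'a::euclidean_space set \<Rightarrow> ('a \<Rightarrow> 'a) \<Rightarrow> 'a \<Rightarrow> 'a \<Rightarrow> ereal" where
  "pair_margin X f c c' =
     (INF x \<in> cluster X f c \<union> cluster X f c'.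
        let y = closest_point (affine hull {c, c'}) x in ereal \<bar>norm (y - c) - norm (y - c')\<bar>)"

definition has_margin :: "'a::euclidean_space set \<Rightarrow> 'a set \<Rightarrow> ereal \<Rightarrow> bool" where
  "has_margin X C d \<longleftrightarrow>
     (\<exists>f. nearest X C id f \<and> (INF c\<in>C. INF c'\<in>C - {c}. pair_margin X f c c') = d)"

definition general_dataset :: "'a::euclidean_space set \<Rightarrow> nat \<Rightarrow> bool" where
  "general_dataset X k \<longleftrightarrow> (\<forall>C\<in>stationary_points X k. \<exists>d>0. has_margin X C d)"

text \<open>
  The distance between a centroid set with set of non-degenerate centroids \<open>J\<close> and the means of a
  clustering \<open>A\<close>. It is only meaningful if \<open>card J = card A\<close>.
\<close>

definition matchings :: "'a set set \<Rightarrow> 'a set \<Rightarrow> ('a set \<Rightarrow> 'a) set" where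
  "matchings A J = {p \<in> A \<rightarrow>\<^sub>E J. bij_betw p A J}"

definition match_cost :: "'a::euclidean_space set set \<Rightarrow> ('a set \<Rightarrow> 'a) \<Rightarrow> real" where
  "match_cost A p = (\<Sum>P\<in>A. real (card P) * (norm (p P - mean P))\<^sup>2)"

definition centroid_dist :: "'a::euclidean_space set \<Rightarrow> 'a set set \<Rightarrow> real" where
  "centroid_dist J A = Min (match_cost A ` matchings A J)"

text \<open>
  If several matchings attain the distance, the smallest resulting value is taken.
\<close>

definition clust_dist :: "'a::euclidean_space set \<Rightarrow> ('a \<Rightarrow> 'a) \<Rightarrow> 'a set set \<Rightarrow> real" where
  "clust_dist X f A =
     Min ((\<lambda>p. Max ((\<lambda>P. real (card (sym_diff (cluster X f (p P)) P)) / real (card P)) ` A))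
        ` {p \<in> matchings A (f ` X). match_cost A p = centroid_dist (f ` X) A})"

text \<open>\<open>(b\<^sub>0, 0)\<close>-stability of the stationary point \<open>means A\<close>.\<close>

definition zero_stable :: "'a::euclidean_space set \<Rightarrow> real \<Rightarrow> 'a set set \<Rightarrow> bool" where
  "zero_stable X b0 A \<longleftrightarrow>
     (\<forall>C f. finite C \<and> nearest X C id f \<and> card (f ` X) = card A
            \<and> centroid_dist (f ` X) A \<le> b0 * kcost X (means A)
        \<longrightarrow> clust_dist X f A = 0)"

definition is_rmin :: "'a::euclidean_space set \<Rightarrow> nat \<Rightarrow> real \<Rightarrow> bool" where
  "is_rmin X k r \<longleftrightarrow>
     r > 0
     \<and> (\<forall>A\<in>stationary_clusterings X k. zero_stable X r A)
     \<and> (\<forall>C f. finite C \<and> nearest X C id f \<and> induced X f \<in> clusterings X k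
              \<and> means (induced X f) \<notin> stationary_points X k
          \<longrightarrow> centroid_dist (f ` X) (induced X f) \<ge> r * kcost X (means (induced X f)))"

text \<open>
  A run of stochastic \<open>k\<close>-means on a probability space \<open>M\<close>, with \<open>F t\<close> the information available
  after iteration \<open>t\<close>. The draws of iteration \<open>t\<close> are \<open>S t i\<close> for \<open>i < m\<close>, the centroids after it
  \<open>C t \<omega> r\<close> for \<open>r < k\<close>, and \<open>a t \<omega>\<close> is the nearest-centroid map used in it. Ties may be broken in
  any way, also randomly or depending on the past, as long as the mini-batch about to be drawn is
  not anticipated. Assumption \<open>sample_uniform\<close> says that, given the past, a mini-batch consists of
  \<open>m\<close> independent uniform draws from \<open>X\<close>.
\<close>

locale stochastic_kmeans = prob_space M + filtration "space M" F
  for M :: "'w measure" and F :: "nat \<Rightarrow> 'w measure" +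
  fixes X :: "'a::euclidean_space set" and k m :: nat and \<eta> :: "nat \<Rightarrow> nat \<Rightarrow> real"
    and c0 :: "nat \<Rightarrow> 'a"
    and S :: "nat \<Rightarrow> nat \<Rightarrow> 'w \<Rightarrow> 'a"
    and a :: "nat \<Rightarrow> 'w \<Rightarrow> 'a \<Rightarrow> nat"
    and C :: "nat \<Rightarrow> 'w \<Rightarrow> nat \<Rightarrow> 'a"
  assumes subalg: "subalgebra M (F t)"
    and sample_measurable:
      "i < m \<Longrightarrow> S (Suc t) i \<in> F (Suc t) \<rightarrow>\<^sub>M count_space X"
    and sample_uniform:
      "B \<in> sets (F t) \<Longrightarrow> xs \<in> {..<m} \<rightarrow> X \<Longrightarrow>
       prob (B \<inter> {\<omega> \<in> space M. \<forall>i<m. S (Suc t) i \<omega> = xs i}) = prob B * (1 / real (card X)) ^ m"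
    and assign_measurable:
      "x \<in> X \<Longrightarrow> (\<lambda>\<omega>. a (Suc t) \<omega> x) \<in> F t \<rightarrow>\<^sub>M count_space {..<k}"
    and assign_nearest:
      "\<omega> \<in> space M \<Longrightarrow> nearest X {..<k} (C t \<omega>) (a (Suc t) \<omega>)"
    and init:
      "\<omega> \<in> space M \<Longrightarrow> r < k \<Longrightarrow> C 0 \<omega> r = c0 r"
    and step:
      "\<omega> \<in> space M \<Longrightarrow> r < k \<Longrightarrow>
       C (Suc t) \<omega> r =
         (let I = {i. i < m \<and> a (Suc t) \<omega> (S (Suc t) i \<omega>) = r} in
          if I = {} then C t \<omega> r
          else (1 - \<eta> r (Suc t)) *\<^sub>R C t \<omega> r
               + \<eta> r (Suc t) *\<^sub>R ((\<Sum>i\<in>I. S (Suc t) i \<omega>) /\<^sub>R real (card I)))"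

end

theory Submission
  imports Defs
begin

text \<open>
  Let \<open>Y\<close> be the cost of the current centroids, \<open>D\<close> its excess over the cost of the means of the
  current clusters, and \<open>\<beta> = 1 - exp (- m / n)\<close>, a lower bound for the probability that a mini-batch
  contains a given data point. One step changes \<open>Y\<close> by \<open>O(\<eta>)\<close>, and by at most
  \<open>- 2 \<beta> \<eta> D + O(\<eta>\<^sup>2)\<close> in expectation. Since the rates \<open>\<eta>\<close> are not summable but their squares are, \<open>D\<close> is almost surely small infinitely often and \<open>Y\<close>
  eventually makes no upcrossings of a fixed interval. When \<open>D\<close> is small, the current clustering has
  the cost of a stationary clustering, one of finitely many levels. So almost surely \<open>Y\<close> is
  eventually trapped near a level \<open>l\<close>, and \<open>G(A)\<close> is the event that this happens for the level of
  \<open>A\<close> from a late deterministic time on.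

  While \<open>Y\<close> is near \<open>l\<close>, either \<open>D = Y - l\<close> or \<open>D\<close> is bounded below. In the first case \<open>Y - l\<close>
  contracts by \<open>1 - 2 \<beta> \<eta>\<close>, where \<open>\<beta> c' > 1\<close>; in the second case the drift is even stronger. This
  gives the rate \<open>O(1/t)\<close> for the positive part of \<open>Y - l\<close>. Below \<open>l\<close> only the second case occurs, so
  that the probability of ever returning from depth \<open>y\<close> decays exponentially in \<open>y / \<eta>\<close>, which
  bounds the negative part on \<open>G(A)\<close> by \<open>O(\<eta>)\<close>.
\<close>

subsection \<open>Clusters and their means\<close>

text \<open>The event on which the rate is claimed looks at the whole future: the cost stays near
  \<open>l\<close> forever. The drift inequality is available for weights known at time
  \<open>t\<close>, so it cannot be used under this conditioning. Expectations are therefore taken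
  with an indicator and divided by the probability only at the very end. The deviation from
  \<open>l\<close> is split by sign, and each part is dominated by an adapted process: above the
  level one that is killed on leaving the band, below it one that is stopped on returning to the
  level or on leaving the band downwards. The signs behave differently because
  \<open>D \<ge> 0\<close>. Below a level \<open>D = Y - l\<close> is impossible, so a path there
  tends to sink further. What rules this out on the event is that \<open>D\<close> becomes small
  infinitely often, which forces a trapped path back up. Limits are costs rather than clusterings:
  several stationary clusterings may share a level, and they then share an event.\<close>

lemma sum_diff_mean:
  fixes P :: "'a::euclidean_space set"
  assumes "finite P"
  shows "(\<Sum>x\<in>P. x - mean P) = 0"
proof (cases "P = {}")
  case False
  then show ?thesis
    using assms by (simp add: sum_subtractf mean_def sum_constant_scaleR)
qed auto

lemma sum_diff_const_mean:
  fixes P :: "'a::euclidean_space set"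
  assumes "finite P"
  shows "(\<Sum>x\<in>P. x - c) = real (card P) *\<^sub>R (mean P - c)"
proof -
  have "(\<Sum>x\<in>P. x - c) = (\<Sum>x\<in>P. (x - mean P) + (mean P - c))" by simp
  also have "\<dots> = real (card P) *\<^sub>R (mean P - c)"
    by (simp only: sum.distrib sum_diff_mean[OF assms] sum_constant_scaleR) simp
  finally show ?thesis .
qed

lemma sum_over_clusters:
  fixes h :: "'a \<Rightarrow> 'b::comm_monoid_add"
  assumes "finite X" "finite I" "f ` X \<subseteq> I"
  shows "(\<Sum>x\<in>X. h x) = (\<Sum>r\<in>I. \<Sum>x\<in>cluster X f r. h x)"
  unfolding cluster_def using sum.group[OF assms, of h] by simp

text \<open>Indexed by data points instead of labels: empty clusters never enter, and the map can
  itself serve as an assignment of points to centroids.\<close>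

definition centre :: "'a::euclidean_space set \<Rightarrow> ('a \<Rightarrow> 'i) \<Rightarrow> 'a \<Rightarrow> 'a" where
  "centre X f x = mean (cluster X f (f x))"

lemma centre_on_cluster: "x \<in> cluster X f r \<Longrightarrow> centre X f x = mean (cluster X f r)"
  by (simp add: centre_def cluster_def)

text \<open>Within each cluster the cross terms cancel, because deviations from the mean sum to
  zero. The last sum will be the excess \<open>D\<close>; the sum before it depends on the
  assignment alone and so takes only finitely many values.\<close>

lemma pythagoras_clusters:
  fixes X :: "'a::euclidean_space set"
  assumes X: "finite X"
  shows "(\<Sum>x\<in>X. (norm (x - c (f x)))\<^sup>2)
       = (\<Sum>x\<in>X. (norm (x - centre X f x))\<^sup>2) + (\<Sum>x\<in>X. (norm (c (f x) - centre X f x))\<^sup>2)"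
proof -
  have cross: "(\<Sum>x\<in>X. (x - centre X f x) \<bullet> (centre X f x - c (f x))) = 0"
  proof -
    have "(\<Sum>x\<in>cluster X f r. (x - centre X f x) \<bullet> (centre X f x - c (f x))) = 0" for r
    proof -
      have "(\<Sum>x\<in>cluster X f r. (x - centre X f x) \<bullet> (centre X f x - c (f x)))
          = (\<Sum>x\<in>cluster X f r. (x - mean (cluster X f r)) \<bullet> (mean (cluster X f r) - c r))"
        by (rule sum.cong) (auto simp: centre_on_cluster, simp add: cluster_def)
      also have "\<dots> = 0"
        by (subst inner_sum_left[symmetric]) (simp add: sum_diff_mean X cluster_def)
      finally show ?thesis .
    qed
    then show ?thesis
      by (subst sum_over_clusters[OF X, of "f ` X" f]) (auto simp: X)
  qed
  have eq: "(norm (x - c (f x)))\<^sup>2 = (norm (x - centre X f x))\<^sup>2 + (norm (c (f x) - centre X f x))\<^sup>2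
      + 2 * ((x - centre X f x) \<bullet> (centre X f x - c (f x)))" for x
    unfolding power2_norm_eq_inner by (simp add: inner_diff inner_commute algebra_simps)
  have "(\<Sum>x\<in>X. (norm (x - c (f x)))\<^sup>2) = (\<Sum>x\<in>X. (norm (x - centre X f x))\<^sup>2 + (norm (c (f x) - centre X f x))\<^sup>2
      + 2 * ((x - centre X f x) \<bullet> (centre X f x - c (f x))))"
    by (rule sum.cong[OF refl eq])
  also have "\<dots> = (\<Sum>x\<in>X. (norm (x - centre X f x))\<^sup>2) + (\<Sum>x\<in>X. (norm (c (f x) - centre X f x))\<^sup>2)
      + 2 * (\<Sum>x\<in>X. (x - centre X f x) \<bullet> (centre X f x - c (f x)))"
    by (simp add: sum.distrib sum_distrib_left)
  finally show ?thesis using cross by simp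
qed

lemma kcost_nearest:
  assumes "nearest X I c f" "finite I"
  shows "kcost X (c ` I) = (\<Sum>x\<in>X. (norm (x - c (f x)))\<^sup>2)"
  unfolding kcost_def
proof (rule sum.cong)
  fix x assume x: "x \<in> X"
  with assms show "Min ((\<lambda>c. (norm (x - c))\<^sup>2) ` c ` I) = (norm (x - c (f x)))\<^sup>2"
    unfolding nearest_def by (intro Min_eqI) (auto intro!: power_mono)
qed simp

lemma kcost_le_assigned:
  assumes "finite X" "finite I" "f ` X \<subseteq> I"
  shows "kcost X (c ` I) \<le> (\<Sum>x\<in>X. (norm (x - c (f x)))\<^sup>2)"
  unfolding kcost_def using assms by (intro sum_mono Min_le) auto

text \<open>Assigning by \<open>centre X f\<close> merges the \<open>f\<close>-clusters that share
  the mean \<open>y\<close>; on each of them the deviations from \<open>y\<close> sum to zero, hence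
  also on their union.\<close>

lemma mean_merged:
  fixes X :: "'a::euclidean_space set"
  assumes X: "finite X" and y: "y \<in> centre X f ` X"
  shows "mean (cluster X (centre X f) y) = y"
proof -
  let ?P = "cluster X (centre X f) y"
  have fP: "finite ?P" using X by (simp add: cluster_def)
  have ne: "?P \<noteq> {}" using y by (auto simp: cluster_def)
  have "(\<Sum>x\<in>cluster ?P f r. x - y) = 0" if "r \<in> f ` ?P" for r
  proof -
    from that obtain z where z: "z \<in> X" "centre X f z = y" "r = f z" by (auto simp: cluster_def)
    have my: "mean (cluster X f r) = y" using z by (simp add: centre_def)
    have "cluster ?P f r = cluster X f r" using my by (auto simp: cluster_def centre_def)
    then show ?thesis using sum_diff_mean[of "cluster X f r"] my X by (simp add: cluster_def)
  qed
  then have "(\<Sum>x\<in>?P. x - y) = 0"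
    by (subst sum_over_clusters[OF fP, of "f ` ?P" f]) (auto simp: fP)
  then have "real (card ?P) *\<^sub>R (mean ?P - y) = 0" using sum_diff_const_mean[OF fP] by metis
  then show ?thesis using ne fP by auto
qed

text \<open>The witness is the clustering induced by \<open>centre X f\<close> itself: each of its
  clusters has its own mean as label, so \<open>near\<close> is literally the nearest-centroid
  condition for these means. Merging can only reduce the number of clusters.\<close>

lemma stationary_of_centres:
  fixes X :: "'a::euclidean_space set" and f :: "'a \<Rightarrow> 'i"
  assumes X: "finite X" "X \<noteq> {}" and f: "f ` X \<subseteq> I" "finite I" "card I \<le> k"
    and near: "\<And>x z. x \<in> X \<Longrightarrow> z \<in> X \<Longrightarrow> norm (x - centre X f x) \<le> norm (x - centre X f z)"
  shows "\<exists>A\<in>stationary_clusterings X k. kcost X (means A) = (\<Sum>x\<in>X. (norm (x - centre X f x))\<^sup>2)"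
proof
  let ?g = "centre X f"
  let ?A = "induced X ?g"
  have "means ?A = (\<lambda>y. mean (cluster X ?g y)) ` ?g ` X"
    unfolding means_def induced_def by (rule image_image)
  also have "\<dots> = (\<lambda>y. y) ` ?g ` X"
    by (rule image_cong[OF refl mean_merged[OF X(1)]])
  finally have means: "means ?A = ?g ` X" by simp
  have nst: "nearest X (?g ` X) id ?g"
    using near by (auto simp: nearest_def)
  have part: "partition_on X ?A"
    by (rule partition_onI) (auto simp: induced_def cluster_def disjnt_def)
  have "?g ` X = (\<lambda>r. mean (cluster X f r)) ` f ` X" by (auto simp: centre_def)
  then have "card (?g ` X) \<le> card (f ` X)" using X by (metis card_image_le finite_imageI)
  moreover have "card (f ` X) \<le> k" using f card_mono by (meson le_trans)
  moreover have "card ?A \<le> card (?g ` X)"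
    unfolding induced_def using X by (intro card_image_le) auto
  moreover have "card ?A \<ge> 1"
    using X by (simp add: Suc_le_eq card_gt_0_iff induced_def)
  ultimately show "?A \<in> stationary_clusterings X k"
    unfolding stationary_clusterings_def clusterings_def voronoi_def
    using part nst[folded means] by auto
  show "kcost X (means ?A) = (\<Sum>x\<in>X. (norm (x - ?g x))\<^sup>2)"
    unfolding means using kcost_nearest[OF nst] X by simp
qed

text \<open>
  Only finitely many distances between data points and cluster means occur, so centroids that are
  close enough to the means of their clusters yield a stationary clustering, after merging the
  clusters with equal means.
\<close>

lemma stationary_if_near_centres:
  fixes X :: "'a::euclidean_space set"
  assumes X: "finite X" "X \<noteq> {}"
  obtains e where "e > 0"
    "\<And>c f. nearest X {..<k} c f \<Longrightarrow> (\<Sum>x\<in>X. (norm (c (f x) - centre X f x))\<^sup>2) < e \<Longrightarrow>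
      \<exists>A\<in>stationary_clusterings X k. kcost X (means A) = (\<Sum>x\<in>X. (norm (x - centre X f x))\<^sup>2)"
proof -
  \<comment> \<open>The positive differences of distances from a data point to means of subsets;
    \<open>1\<close> makes the set nonempty. If nearness fails for the means, it fails by at least
    the minimum \<open>g\<close>.\<close>
  define Q where "Q = insert 1 ((\<lambda>(x,P,P'). norm (x - mean P) - norm (x - mean P')) ` (X \<times> Pow X \<times> Pow X)
    \<inter> {0<..})"
  have Q: "finite Q" "Q \<noteq> {}" "\<And>q. q \<in> Q \<Longrightarrow> q > 0" using X by (auto simp: Q_def)
  define g where "g = Min Q"
  have g: "g > 0" using Q by (simp add: g_def)
  show ?thesis
  proof (rule that[of "(g/2)\<^sup>2"])
    show "(g/2)\<^sup>2 > 0" using g by simp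
    fix c :: "nat \<Rightarrow> 'a" and f
    assume n: "nearest X {..<k} c f" and s: "(\<Sum>x\<in>X. (norm (c (f x) - centre X f x))\<^sup>2) < (g/2)\<^sup>2"
    \<comment> \<open>Each of the two centroids in a comparison is closer than \<open>g / 2\<close>
      to its mean, so passing between means and centroids costs less than \<open>g\<close> in
      total.\<close>
    have d: "norm (c (f x) - centre X f x) < g / 2" if "x \<in> X" for x
    proof -
      have "(norm (c (f x) - centre X f x))\<^sup>2 \<le> (\<Sum>x\<in>X. (norm (c (f x) - centre X f x))\<^sup>2)"
        using X that by (intro member_le_sum) auto
      then have "(norm (c (f x) - centre X f x))\<^sup>2 < (g/2)\<^sup>2" using s by linarith
      then show ?thesis using g by (intro power2_less_imp_less[of _ "g/2"]) auto
    qed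
    have "norm (x - centre X f x) \<le> norm (x - centre X f z)" if xz: "x \<in> X" "z \<in> X" for x z
    proof (rule ccontr)
      assume "\<not> ?thesis"
      then have pos: "norm (x - centre X f x) - norm (x - centre X f z) > 0" by simp
      have "norm (x - centre X f x) - norm (x - centre X f z) \<in> Q"
        unfolding Q_def
        by (intro insertI2 IntI image_eqI[of _ _ "(x, cluster X f (f x), cluster X f (f z))"])
          (use pos xz in \<open>auto simp: centre_def cluster_def\<close>)
      then have ge: "g \<le> norm (x - centre X f x) - norm (x - centre X f z)"
        unfolding g_def using Q by simp
      have "norm (x - c (f x)) \<le> norm (x - c (f z))" using n xz by (auto simp: nearest_def)
      moreover have "norm (x - centre X f x) \<le> norm (x - c (f x)) + norm (c (f x) - centre X f x)"
        by (metis diff_add_cancel add_diff_eq norm_triangle_ineq)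
      moreover have "norm (x - c (f z)) \<le> norm (x - centre X f z) + norm (c (f z) - centre X f z)"
        by (metis diff_add_cancel add_diff_eq norm_triangle_ineq norm_minus_commute)
      ultimately show False using ge d[OF xz(1)] d[OF xz(2)] by linarith
    qed
    moreover have "f ` X \<subseteq> {..<k}" using n by (auto simp: nearest_def)
    ultimately show "\<exists>A\<in>stationary_clusterings X k. kcost X (means A) = (\<Sum>x\<in>X. (norm (x - centre X f x))\<^sup>2)"
      using stationary_of_centres[OF X, of f "{..<k}" k] by simp
  qed
qed

lemma finite_stationary_clusterings:
  assumes "finite X"
  shows "finite (stationary_clusterings X k)"
proof (rule finite_subset)
  show "stationary_clusterings X k \<subseteq> Pow (Pow X)"
    by (auto simp: stationary_clusterings_def clusterings_def partition_on_def)
qed (use assms in auto)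

subsection \<open>Averaging over mini-batches\<close>

text \<open>The summand is a product over coordinates with factor 1 except at \<open>i\<close>, so
  the sum factorises and contains the vanishing factor at \<open>i\<close>.\<close>

lemma sum_PiE_coordinate:
  fixes h :: "'a \<Rightarrow> real"
  assumes I: "finite I" "i \<in> I" and B: "\<And>j. j \<in> I \<Longrightarrow> finite (B j)" and s: "(\<Sum>y\<in>B i. h y) = 0"
  shows "(\<Sum>g\<in>PiE I B. h (g i)) = 0"
proof -
  have "(\<Sum>g\<in>PiE I B. h (g i)) = (\<Sum>g\<in>PiE I B. \<Prod>j\<in>I. if j = i then h (g j) else 1)"
    using I by (intro sum.cong) (auto simp: prod.delta)
  also have "\<dots> = (\<Prod>j\<in>I. \<Sum>y\<in>B j. if j = i then h y else 1)"
    using I B by (subst prod_sum_PiE) auto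
  also have "\<dots> = 0"
    by (rule prod_zero) (use I s in \<open>auto intro!: bexI[of _ i]\<close>)
  finally show ?thesis .
qed

text \<open>The direction in which a centroid moves. The value 0 for an empty sub-sample lets one
  formula cover both cases of the update.\<close>

definition displacement :: "nat \<Rightarrow> ('a::euclidean_space \<Rightarrow> nat) \<Rightarrow> (nat \<Rightarrow> 'a) \<Rightarrow> (nat \<Rightarrow> 'a) \<Rightarrow> nat \<Rightarrow> 'a" where
  "displacement m f c xs r = (let I = {i. i < m \<and> f (xs i) = r} in
     if I = {} then 0 else (\<Sum>i\<in>I. xs i) /\<^sub>R real (card I) - c r)"

text \<open>Batches are grouped by the set \<open>I\<close> of positions that hit \<open>P\<close>.
  Given a nonempty \<open>I\<close>, these entries range freely over \<open>P\<close>, so the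
  sub-sample mean averages to \<open>mean P\<close> and the displacement to \<open>u\<close>,
  whatever the size of \<open>I\<close>. The bracket counts the batches that hit \<open>P\<close> at
  all.\<close>

lemma sum_displacement:
  fixes X :: "'a::euclidean_space set" and f :: "'a \<Rightarrow> nat" and r m :: nat and c :: "nat \<Rightarrow> 'a"
  assumes X: "finite X"
  defines "P \<equiv> cluster X f r"
  defines "u \<equiv> mean P - c r"
  shows "(\<Sum>xs\<in>PiE {..<m} (\<lambda>_. X). displacement m f c xs r \<bullet> u)
       = (norm u)\<^sup>2 * (real (card X) ^ m - (real (card X) - real (card P)) ^ m)"
proof -
  define J where "J xs = {i. i < m \<and> f (xs i) = r}" for xs :: "nat \<Rightarrow> 'a"
  define W where "W I = PiE {..<m} (\<lambda>j. if j \<in> I then P else X - P)" for I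
  have fP: "finite P" "P \<subseteq> X" using X by (auto simp: P_def cluster_def)
  have W: "{xs \<in> PiE {..<m} (\<lambda>_. X). J xs = I} = W I" if "I \<subseteq> {..<m}" for I
    unfolding W_def J_def P_def cluster_def using that
    by (auto simp: PiE_iff extensional_def split: if_splits)
  have grp: "(\<Sum>xs\<in>PiE {..<m} (\<lambda>_. X). h xs) = (\<Sum>I\<in>Pow {..<m}. \<Sum>xs\<in>W I. h xs)" for h :: "_ \<Rightarrow> real"
  proof -
    have "(\<Sum>xs\<in>PiE {..<m} (\<lambda>_. X). h xs)
        = (\<Sum>I\<in>Pow {..<m}. \<Sum>xs\<in>{xs \<in> PiE {..<m} (\<lambda>_. X). J xs = I}. h xs)"
      by (rule sum.group[symmetric]) (auto simp: X J_def intro!: finite_PiE)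
    also have "\<dots> = (\<Sum>I\<in>Pow {..<m}. \<Sum>xs\<in>W I. h xs)"
      by (rule sum.cong) (auto simp: W)
    finally show ?thesis .
  qed
  have fin: "finite (W I)" for I unfolding W_def using X fP by (intro finite_PiE) auto
  have JW: "J xs = I" if "xs \<in> W I" "I \<subseteq> {..<m}" for xs I using W that by blast
  have part: "(\<Sum>xs\<in>W I. displacement m f c xs r \<bullet> u) = (norm u)\<^sup>2 * real (card (W I))"
    if I: "I \<subseteq> {..<m}" "I \<noteq> {}" for I
  proof -
    have fI: "finite I" using I finite_subset by blast
    have "(\<Sum>xs\<in>W I. displacement m f c xs r \<bullet> u)
        = (\<Sum>xs\<in>W I. (\<Sum>i\<in>I. (xs i - mean P) \<bullet> u) / real (card I) + (norm u)\<^sup>2)"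
    proof (rule sum.cong)
      fix xs assume "xs \<in> W I"
      then have "J xs = I" using JW I by blast
      then have "displacement m f c xs r = (\<Sum>i\<in>I. xs i) /\<^sub>R real (card I) - c r"
        using I by (simp add: displacement_def J_def)
      also have "\<dots> = (\<Sum>i\<in>I. xs i - mean P) /\<^sub>R real (card I) + u"
        using I fI by (simp add: u_def sum_subtractf sum_constant_scaleR scaleR_diff_right)
      finally show "displacement m f c xs r \<bullet> u = (\<Sum>i\<in>I. (xs i - mean P) \<bullet> u) / real (card I) + (norm u)\<^sup>2"
        by (simp add: inner_add_left inner_sum_left power2_norm_eq_inner divide_inverse mult.commute)
    qed simp
    also have "\<dots> = (\<Sum>i\<in>I. \<Sum>xs\<in>W I. (xs i - mean P) \<bullet> u) / real (card I) + (norm u)\<^sup>2 * real (card (W I))"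
      by (subst sum.swap[of _ "W I"]) (simp add: sum.distrib sum_divide_distrib mult.commute)
    also have "(\<Sum>i\<in>I. \<Sum>xs\<in>W I. (xs i - mean P) \<bullet> u) = 0"
    proof (rule sum.neutral, rule ballI)
      fix i assume i: "i \<in> I"
      have "(\<Sum>y\<in>P. (y - mean P) \<bullet> u) = 0"
        by (subst inner_sum_left[symmetric]) (simp add: sum_diff_mean fP)
      then show "(\<Sum>xs\<in>W I. (xs i - mean P) \<bullet> u) = 0"
        unfolding W_def using i I X fP
        by (intro sum_PiE_coordinate[where h = "\<lambda>y. (y - mean P) \<bullet> u"]) auto
    qed
    finally show ?thesis by simp
  qed
  have empty: "(\<Sum>xs\<in>W {}. displacement m f c xs r \<bullet> u) = 0"
  proof (rule sum.neutral, rule ballI)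
    fix xs assume "xs \<in> W {}"
    then have "J xs = {}" using JW by blast
    then show "displacement m f c xs r \<bullet> u = 0" by (simp add: displacement_def J_def)
  qed
  have "card (W {}) = card (X - P) ^ m" unfolding W_def by (simp add: card_PiE)
  then have cW: "real (card (W {})) = (real (card X) - real (card P)) ^ m"
    using fP X by (simp add: card_Diff_subset of_nat_diff card_mono)
  have "real (card X) ^ m = (\<Sum>xs\<in>PiE {..<m} (\<lambda>_. X). 1)" by (simp add: card_PiE)
  also have "\<dots> = (\<Sum>I\<in>Pow {..<m}. real (card (W I)))" by (subst grp) simp
  also have "\<dots> = real (card (W {})) + (\<Sum>I\<in>Pow {..<m} - {{}}. real (card (W I)))"
    by (rule sum.remove) auto
  finally have tot: "(\<Sum>I\<in>Pow {..<m} - {{}}. real (card (W I)))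
      = real (card X) ^ m - (real (card X) - real (card P)) ^ m" using cW by simp
  have "(\<Sum>xs\<in>PiE {..<m} (\<lambda>_. X). displacement m f c xs r \<bullet> u)
      = (\<Sum>I\<in>Pow {..<m}. \<Sum>xs\<in>W I. displacement m f c xs r \<bullet> u)" by (rule grp)
  also have "\<dots> = (\<Sum>xs\<in>W {}. displacement m f c xs r \<bullet> u)
      + (\<Sum>I\<in>Pow {..<m} - {{}}. \<Sum>xs\<in>W I. displacement m f c xs r \<bullet> u)"
    by (rule sum.remove) auto
  also have "\<dots> = (\<Sum>I\<in>Pow {..<m} - {{}}. (norm u)\<^sup>2 * real (card (W I)))"
    unfolding empty by (simp add: part)
  also have "\<dots> = (norm u)\<^sup>2 * (real (card X) ^ m - (real (card X) - real (card P)) ^ m)"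
    by (simp only: sum_distrib_left[symmetric] tot)
  finally show ?thesis .
qed

text \<open>A batch misses \<open>p \<ge> 1\<close> points at most as often as a single point, and
  \<open>1 - x \<le> exp (- x)\<close>.\<close>

lemma prob_hit_ge:
  fixes p n :: real
  assumes "1 \<le> p" "p \<le> n"
  shows "1 - exp (- real m / n) \<le> (n ^ m - (n - p) ^ m) / n ^ m"
proof -
  have n: "n > 0" using assms by simp
  have "(n - p) / n \<le> 1 + - 1 / n" using assms n by (simp add: field_simps)
  also have "\<dots> \<le> exp (- 1 / n)" by (rule exp_ge_add_one_self)
  finally have "((n - p) / n) ^ m \<le> exp (- 1 / n) ^ m"
    using assms n by (intro power_mono) auto
  also have "\<dots> = exp (- real m / n)" by (simp add: exp_of_nat_mult[symmetric])
  finally show ?thesis using n by (simp add: power_divide field_simps)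
qed

subsection \<open>Bounded processes with drift\<close>

text \<open>\<open>drift_le\<close> is a bound on a conditional expectation in integrated form,
  tested with bounded nonnegative weights known at time \<open>t\<close>. \<open>\<xi>\<close> is
  the cost change before points are reassigned, whence the inequality in \<open>Y_step\<close>;
  \<open>\<xi>_ge\<close> says that it cannot take the cost below that of the cluster means. The
  \<open>+ 1\<close> in the rate is there because the step from time \<open>t\<close> is iteration
  \<open>t + 1\<close>.\<close>

locale drift_process = prob_space M + filtration "space M" F
  for M :: "'w measure" and F :: "nat \<Rightarrow> 'w measure" +
  fixes Y D \<xi> :: "nat \<Rightarrow> 'w \<Rightarrow> real" and L :: "real set" and \<epsilon> \<beta> R K c q :: real
    and \<eta> :: "nat \<Rightarrow> real"
  assumes subalg: "subalgebra M (F t)"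
    and Y_meas: "Y t \<in> borel_measurable (F t)"
    and D_meas: "D t \<in> borel_measurable (F t)"
    and \<xi>_meas: "\<xi> t \<in> borel_measurable M"
    and Y_bounds: "\<omega> \<in> space M \<Longrightarrow> 0 \<le> Y t \<omega> \<and> Y t \<omega> \<le> R"
    and D_bounds: "\<omega> \<in> space M \<Longrightarrow> 0 \<le> D t \<omega> \<and> D t \<omega> \<le> R"
    and \<xi>_abs: "\<omega> \<in> space M \<Longrightarrow> \<bar>\<xi> t \<omega>\<bar> \<le> K * \<eta> t"
    and \<xi>_ge: "\<omega> \<in> space M \<Longrightarrow> - D t \<omega> \<le> \<xi> t \<omega>"
    and Y_step: "\<omega> \<in> space M \<Longrightarrow> Y (Suc t) \<omega> \<le> Y t \<omega> + \<xi> t \<omega>"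
    and drift_le: "w \<in> borel_measurable (F t) \<Longrightarrow> (\<And>\<omega>. \<omega> \<in> space M \<Longrightarrow> 0 \<le> w \<omega> \<and> w \<omega> \<le> W) \<Longrightarrow>
        (\<integral>\<omega>. w \<omega> * \<xi> t \<omega> \<partial>M) \<le> (\<integral>\<omega>. w \<omega> * (K * (\<eta> t)\<^sup>2 - 2 * \<beta> * \<eta> t * D t \<omega>) \<partial>M)"
    and finite_levels: "finite L"
    and \<epsilon>: "\<epsilon> > 0"
    and level_reached: "\<omega> \<in> space M \<Longrightarrow> D t \<omega> < \<epsilon> \<Longrightarrow> Y t \<omega> - D t \<omega> \<in> L"
    and \<eta>: "\<eta> t = c / (real t + 1 + q)"
    and constants: "K > 0" "0 < \<beta>" "\<beta> \<le> 1" "\<beta> * c > 1" "c \<le> 1 + q"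
begin

section \<open>Step sizes, measurability and the supermartingale step\<close>

lemma c_gt_1: "c > 1"
proof (rule ccontr)
  assume "\<not> c > 1"
  then have "\<beta> * c \<le> 1 * 1" using constants by (intro mult_mono') (auto simp: not_less, smt (verit) mult_nonneg_nonpos)
  then show False using constants by simp
qed

lemma q_pos: "q > 0" using c_gt_1 constants by simp

lemma \<eta>_pos: "\<eta> t > 0" using c_gt_1 q_pos by (simp add: \<eta>)

lemma \<eta>_antimono: "s \<le> t \<Longrightarrow> \<eta> t \<le> \<eta> s"
  using c_gt_1 q_pos by (simp add: \<eta> frac_le)

lemma \<eta>_le: "t \<ge> 1 \<Longrightarrow> \<eta> t \<le> c / real t"
  using c_gt_1 q_pos by (simp add: \<eta> frac_le)

lemma \<eta>_sq_summable: "summable (\<lambda>t. (\<eta> t)\<^sup>2)"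
proof (rule summable_comparison_test')
  show "summable (\<lambda>t. c\<^sup>2 * inverse (real (Suc t) ^ 2))"
    using inverse_power_summable[of 2, where 'a = real] summable_Suc_iff[of "\<lambda>n. inverse (real n ^ 2)"]
    by (intro summable_mult) auto
  fix t :: nat assume "0 \<le> t"
  have "\<eta> t \<le> c / real (Suc t)" unfolding \<eta> using c_gt_1 q_pos by (intro frac_le) auto
  then have "(\<eta> t)\<^sup>2 \<le> (c / real (Suc t))\<^sup>2" using \<eta>_pos[of t] by (intro power_mono) auto
  then show "norm ((\<eta> t)\<^sup>2) \<le> c\<^sup>2 * inverse (real (Suc t) ^ 2)"
    by (simp add: power_divide divide_inverse power_mult_distrib power_inverse del: of_nat_Suc)
qed

lemma \<eta>_tendsto: "\<eta> \<longlonglongrightarrow> 0"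
proof -
  have "(\<lambda>t. (\<eta> t)\<^sup>2) \<longlonglongrightarrow> 0" using summable_LIMSEQ_zero[OF \<eta>_sq_summable] .
  then have "(\<lambda>t. sqrt ((\<eta> t)\<^sup>2)) \<longlonglongrightarrow> sqrt 0" by (rule tendsto_real_sqrt)
  then show ?thesis using \<eta>_pos by (simp add: less_imp_le)
qed

lemma \<eta>_sum_unbounded: "\<exists>N. (\<Sum>t\<in>{T..<N}. \<eta> t) > B"
proof (rule ccontr)
  assume "\<nexists>N. (\<Sum>t\<in>{T..<N}. \<eta> t) > B"
  then have b: "(\<Sum>t\<in>{T..<N}. \<eta> t) \<le> B" for N by (simp add: not_less)
  have "summable \<eta>"
  proof (rule summableI_nonneg_bounded[where x = "(\<Sum>t<T. \<eta> t) + B"])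
    show "0 \<le> \<eta> t" for t using \<eta>_pos less_imp_le by blast
    show "sum \<eta> {..<N} \<le> (\<Sum>t<T. \<eta> t) + B" for N
    proof -
      have "sum \<eta> {..<N} \<le> sum \<eta> ({..<T} \<union> {T..<N})"
        using \<eta>_pos by (intro sum_mono2) (auto intro: less_imp_le)
      also have "\<dots> = sum \<eta> {..<T} + sum \<eta> {T..<N}" by (rule sum.union_disjoint) auto
      finally show ?thesis using b[of N] by simp
    qed
  qed
  then have "summable (\<lambda>t. (1 + q) * \<eta> t)" by (rule summable_mult)
  then have "summable (\<lambda>t. inverse (real (Suc t)))"
  proof (rule summable_comparison_test'[where N = 0])
    fix t :: nat
    have "real t + 1 + q \<le> (1 + q) * real (Suc t)" using q_pos by (simp add: algebra_simps)
    then have "(1 + q) / ((1 + q) * real (Suc t)) \<le> (1 + q) / (real t + 1 + q)"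
      using q_pos by (intro divide_left_mono mult_pos_pos) auto
    also have "\<dots> \<le> (1 + q) * c / (real t + 1 + q)"
      using q_pos c_gt_1 by (intro divide_right_mono) auto
    also have "\<dots> = (1 + q) * \<eta> t" by (simp add: \<eta>)
    finally have "(1 + q) / ((1 + q) * real (Suc t)) \<le> (1 + q) * \<eta> t" .
    moreover have "(1 + q) / ((1 + q) * real (Suc t)) = inverse (real (Suc t))"
      using q_pos by (simp add: divide_inverse)
    ultimately show "norm (inverse (real (Suc t))) \<le> (1 + q) * \<eta> t" by simp
  qed
  then have "summable (\<lambda>t. inverse (real t))" by (subst (asm) summable_Suc_iff)
  then show False using not_summable_harmonic[where 'a = real] by simp
qed

lemma from_F: "f \<in> borel_measurable (F t) \<Longrightarrow> f \<in> borel_measurable M"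
  using measurable_from_subalg[OF subalg] .

lemma Y_meas_le: "s \<le> t \<Longrightarrow> Y s \<in> borel_measurable (F t)"
  using Y_meas[of s] sets_F_mono[of s t] space_F[of s] space_F[of t]
  by (auto simp: measurable_def)

lemma Y_meas_M [measurable]: "Y t \<in> borel_measurable M"
  and D_meas_M [measurable]: "D t \<in> borel_measurable M"
  using from_F Y_meas D_meas by auto

declare \<xi>_meas [measurable]

lemma integrable_bounded:
  fixes f :: "'w \<Rightarrow> real"
  assumes "f \<in> borel_measurable M" "\<And>\<omega>. \<omega> \<in> space M \<Longrightarrow> \<bar>f \<omega>\<bar> \<le> B"
  shows "integrable M f"
  using assms by (intro integrable_const_bound[where B = B]) auto

text \<open>The bracket has nonpositive expectation against every admissible weight, so an
  inequality may be proved pointwise with the bracket and integrated afterwards. In the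
  supermartingale arguments below, \<open>w\<close> is the slope of the potential at the current
  state.\<close>

lemma integral_step:
  assumes "integrable M f" "integrable M h"
    and w: "w \<in> borel_measurable (F t)" "\<And>\<omega>. \<omega> \<in> space M \<Longrightarrow> 0 \<le> w \<omega> \<and> w \<omega> \<le> W"
    and le: "\<And>\<omega>. \<omega> \<in> space M \<Longrightarrow>
      f \<omega> \<le> h \<omega> + w \<omega> * (\<xi> t \<omega> + 2 * \<beta> * \<eta> t * D t \<omega> - K * (\<eta> t)\<^sup>2)"
  shows "(\<integral>\<omega>. f \<omega> \<partial>M) \<le> (\<integral>\<omega>. h \<omega> \<partial>M)"
proof -
  have [measurable]: "w \<in> borel_measurable M" using from_F w by blast
  have iw: "integrable M w" using w by (intro integrable_bounded[where B = W]) auto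
  have ib: "integrable M (\<lambda>\<omega>. w \<omega> * g \<omega>)"
    if "g \<in> borel_measurable M" "\<And>\<omega>. \<omega> \<in> space M \<Longrightarrow> \<bar>g \<omega>\<bar> \<le> B" for g B
  proof (rule integrable_bounded[where B = "W * B"])
    fix \<omega> assume "\<omega> \<in> space M"
    then show "\<bar>w \<omega> * g \<omega>\<bar> \<le> W * B" using w that by (auto simp: abs_mult intro!: mult_mono')
  qed (use that in measurable)
  have i1: "integrable M (\<lambda>\<omega>. w \<omega> * \<xi> t \<omega>)" by (rule ib[of "\<xi> t" "K * \<eta> t"]) (use \<xi>_abs in auto)
  have i2: "integrable M (\<lambda>\<omega>. w \<omega> * D t \<omega>)" by (rule ib[of "D t" R]) (use D_bounds in auto)
  have i3: "integrable M (\<lambda>\<omega>. w \<omega> * (K * (\<eta> t)\<^sup>2 - 2 * \<beta> * \<eta> t * D t \<omega>))"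
  proof -
    have "integrable M (\<lambda>\<omega>. w \<omega> * (K * (\<eta> t)\<^sup>2) - (2 * \<beta> * \<eta> t) * (w \<omega> * D t \<omega>))"
      using iw i2 by auto
    then show ?thesis by (simp add: algebra_simps)
  qed
  have "(\<integral>\<omega>. f \<omega> \<partial>M) \<le> (\<integral>\<omega>. h \<omega> + w \<omega> * \<xi> t \<omega> - w \<omega> * (K * (\<eta> t)\<^sup>2 - 2 * \<beta> * \<eta> t * D t \<omega>) \<partial>M)"
  proof (rule integral_mono)
    fix \<omega> assume "\<omega> \<in> space M"
    from le[OF this] show "f \<omega> \<le> h \<omega> + w \<omega> * \<xi> t \<omega> - w \<omega> * (K * (\<eta> t)\<^sup>2 - 2 * \<beta> * \<eta> t * D t \<omega>)"
      by (simp add: algebra_simps)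
  qed (use assms i1 i3 in auto)
  also have "\<dots> = (\<integral>\<omega>. h \<omega> \<partial>M) + (\<integral>\<omega>. w \<omega> * \<xi> t \<omega> \<partial>M)
      - (\<integral>\<omega>. w \<omega> * (K * (\<eta> t)\<^sup>2 - 2 * \<beta> * \<eta> t * D t \<omega>) \<partial>M)"
    using assms i1 i3 by simp
  also have "\<dots> \<le> (\<integral>\<omega>. h \<omega> \<partial>M)" using drift_le[OF w] by simp
  finally show ?thesis .
qed

text \<open>Telescoping the drift bounds the sum of \<open>\<eta> t\<close> times the mean of
  \<open>D t\<close>. If \<open>D\<close> stayed above \<open>e\<close> from \<open>T\<close> on
  with positive probability, this would bound the divergent sum of the rates.\<close>

lemma D_small_infinitely_often:
  assumes e: "e > 0"
  shows "AE \<omega> in M. \<forall>T. \<exists>t\<ge>T. D t \<omega> < e"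
proof -
  have iY: "integrable M (Y t)" for t by (rule integrable_bounded[where B = R]) (use Y_bounds in auto)
  have iD: "integrable M (D t)" for t by (rule integrable_bounded[where B = R]) (use D_bounds in auto)
  define S where "S = R + K * (\<Sum>t. (\<eta> t)\<^sup>2)"
  have E1: "(\<integral>\<omega>. Y N \<omega> \<partial>M) + (\<Sum>t<N. 2 * \<beta> * \<eta> t * (\<integral>\<omega>. D t \<omega> \<partial>M)) \<le> R + K * (\<Sum>t<N. (\<eta> t)\<^sup>2)" for N
  proof (induction N)
    case 0
    have "(\<integral>\<omega>. Y 0 \<omega> \<partial>M) \<le> (\<integral>\<omega>. R \<partial>M)" using iY Y_bounds by (intro integral_mono) auto
    then show ?case by (simp add: prob_space)
  next
    case (Suc N)
    have "(\<integral>\<omega>. Y (Suc N) \<omega> \<partial>M) \<le> (\<integral>\<omega>. Y N \<omega> - 2 * \<beta> * \<eta> N * D N \<omega> + K * (\<eta> N)\<^sup>2 \<partial>M)"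
      by (rule integral_step[where w = "\<lambda>_. 1" and W = 1 and t = N]) (use iY iD Y_step in \<open>auto simp: algebra_simps\<close>)
    also have "\<dots> = (\<integral>\<omega>. Y N \<omega> \<partial>M) - 2 * \<beta> * \<eta> N * (\<integral>\<omega>. D N \<omega> \<partial>M) + K * (\<eta> N)\<^sup>2"
      using iY iD by (simp add: prob_space)
    finally show ?case using Suc by (simp add: algebra_simps)
  qed
  have E2: "K * (\<Sum>t<N. (\<eta> t)\<^sup>2) \<le> K * (\<Sum>t. (\<eta> t)\<^sup>2)" for N
    by (intro mult_left_mono sum_le_suminf[OF \<eta>_sq_summable]) (use constants in auto)
  have E3: "0 \<le> (\<integral>\<omega>. Y N \<omega> \<partial>M)" for N using Y_bounds by (intro integral_nonneg_AE) auto
  have bound: "(\<Sum>t<N. 2 * \<beta> * \<eta> t * (\<integral>\<omega>. D t \<omega> \<partial>M)) \<le> S" for N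
    using E1[of N] E2[of N] E3[of N] unfolding S_def by linarith
  have "AE \<omega> in M. \<exists>t\<ge>T. D t \<omega> < e" for T
  proof -
    define B where "B = {\<omega> \<in> space M. \<forall>t\<ge>T. e \<le> D t \<omega>}"
    have [measurable]: "B \<in> sets M" unfolding B_def by measurable
    have D_ge: "e * prob B \<le> (\<integral>\<omega>. D t \<omega> \<partial>M)" if "t \<ge> T" for t
    proof -
      have "(\<integral>\<omega>. e * indicator B \<omega> \<partial>M) \<le> (\<integral>\<omega>. D t \<omega> \<partial>M)"
      proof (rule integral_mono)
        show "integrable M (\<lambda>\<omega>. e * indicator B \<omega>)" by (simp add: emeasure_eq_measure)
      qed (use iD that D_bounds in \<open>auto simp: B_def indicator_def\<close>)
      then show ?thesis by simp
    qed
    have "prob B = 0"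
    proof (rule ccontr)
      assume "prob B \<noteq> 0"
      then have pB: "prob B > 0" by (simp add: zero_less_measure_iff)
      define k where "k = 2 * \<beta> * (e * prob B)"
      have k: "k > 0" unfolding k_def using pB e constants by simp
      obtain N where N: "(\<Sum>t\<in>{T..<N}. \<eta> t) > S / k" using \<eta>_sum_unbounded by blast
      have "k * (\<Sum>t\<in>{T..<N}. \<eta> t) \<le> (\<Sum>t\<in>{T..<N}. 2 * \<beta> * \<eta> t * (\<integral>\<omega>. D t \<omega> \<partial>M))"
        unfolding sum_distrib_left
      proof (rule sum_mono)
        fix t assume "t \<in> {T..<N}"
        then have "(2 * \<beta> * \<eta> t) * (e * prob B) \<le> (2 * \<beta> * \<eta> t) * (\<integral>\<omega>. D t \<omega> \<partial>M)"
          using D_ge constants \<eta>_pos[of t] by (intro mult_left_mono) auto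
        then show "k * \<eta> t \<le> 2 * \<beta> * \<eta> t * (\<integral>\<omega>. D t \<omega> \<partial>M)" by (simp add: k_def mult_ac)
      qed
      also have "\<dots> \<le> (\<Sum>t<N. 2 * \<beta> * \<eta> t * (\<integral>\<omega>. D t \<omega> \<partial>M))"
      proof (rule sum_mono2)
        show "0 \<le> 2 * \<beta> * \<eta> t * (\<integral>\<omega>. D t \<omega> \<partial>M)" for t
          using D_bounds constants \<eta>_pos[of t] by (intro mult_nonneg_nonneg integral_nonneg_AE) auto
      qed auto
      finally show False using bound[of N] N k by (simp add: field_simps)
    qed
    then have "B \<in> null_sets M" by (simp add: null_setsI emeasure_eq_measure)
    then show ?thesis by (rule AE_I') (auto simp: B_def not_less)
  qed
  then show ?thesis by (simp add: AE_all_countable)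
qed

text \<open>
  The square of the positive part of \<open>Y - a\<close>, started when \<open>Y\<close> is below \<open>a\<close>, is a
  supermartingale up to summable errors.
\<close>

lemma no_upcrossings:
  assumes e: "e > 0"
  shows "AE \<omega> in M. \<exists>T. \<forall>v. \<forall>u\<in>{T..v}. Y u \<omega> \<le> a \<longrightarrow> Y v \<omega> < a + e"
proof -
  \<comment> \<open>\<open>W\<close> bounds the slope \<open>2 * max 0 (Y s \<omega> - a)\<close> of
    the squared positive part. In \<open>K'\<close>, the term \<open>W * K\<close> pays for the
    error in the drift and \<open>K\<^sup>2\<close> for the square of the increment.\<close>
  define W where "W = 2 * (R + \<bar>a\<bar>)"
  define K' where "K' = W * K + K\<^sup>2"
  have R: "R \<ge> 0" using Y_bounds not_empty by fastforce
  have K': "K' \<ge> 0" using R constants by (simp add: K'_def W_def)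
  define tail where "tail T = (\<Sum>t. (\<eta> (t + T))\<^sup>2)" for T
  define U where "U T = {\<omega> \<in> space M. \<exists>v. \<exists>u\<in>{T..v}. Y u \<omega> \<le> a \<and> a + e \<le> Y v \<omega>}" for T
  have U_meas [measurable]: "U T \<in> sets M" for T unfolding U_def by measurable
  have main: "prob (U T) * e\<^sup>2 \<le> K' * tail T" for T
  proof -
    define Bp where "Bp s \<omega> = (\<exists>u\<in>{T..s}. Y u \<omega> \<le> a)" for s \<omega>
    define Hp where "Hp s \<omega> = (\<exists>v\<in>{T..s}. \<exists>u\<in>{T..v}. Y u \<omega> \<le> a \<and> a + e \<le> Y v \<omega>)" for s \<omega>
    \<comment> \<open>A stopped potential: zero until \<open>Y\<close> has been at most
      \<open>a\<close>, then the squared height above \<open>a\<close>, and frozen at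
      \<open>e\<^sup>2\<close> once an upcrossing is complete. \<open>Bp\<close> and
      \<open>Hp\<close> look only at the past, so it is adapted.\<close>
    define g where "g s \<omega> = (if Hp s \<omega> then e\<^sup>2 else if Bp s \<omega> then (max 0 (Y s \<omega> - a))\<^sup>2 else 0)" for s \<omega>
    have BpF: "Measurable.pred (F s) (Bp s)" for s
      unfolding Bp_def using Y_meas_le by (intro pred_intros_finite) auto
    have HpF: "Measurable.pred (F s) (Hp s)" for s
      unfolding Hp_def using Y_meas_le by (intro pred_intros_finite) auto
    have [measurable]: "Measurable.pred M (Bp s)" "Measurable.pred M (Hp s)" for s
      using measurable_from_subalg[OF subalg] BpF HpF by blast+
    have ig: "integrable M (g s)" for s
    proof (rule integrable_bounded[where B = "e\<^sup>2 + (R + \<bar>a\<bar>)\<^sup>2"])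
      show "g s \<in> borel_measurable M" unfolding g_def by measurable
      fix \<omega> assume "\<omega> \<in> space M"
      then have "(max 0 (Y s \<omega> - a))\<^sup>2 \<le> (R + \<bar>a\<bar>)\<^sup>2" using Y_bounds[of \<omega> s] R by (intro power_mono) auto
      then show "\<bar>g s \<omega>\<bar> \<le> e\<^sup>2 + (R + \<bar>a\<bar>)\<^sup>2"
        unfolding g_def by (auto intro: add_increasing)
    qed
    have int_g: "(\<integral>\<omega>. g s \<omega> \<partial>M) \<le> K' * (\<Sum>t\<in>{T..<s}. (\<eta> t)\<^sup>2)" if "T \<le> s" for s
      using that
    proof (induction s rule: dec_induct)
      case base
      have "g T \<omega> = 0" for \<omega> using e by (auto simp: g_def Hp_def Bp_def)
      then show ?case by simp
    next
      case (step s)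
      define w where "w \<omega> = (if Hp s \<omega> \<or> \<not> Bp s \<omega> then 0 else 2 * max 0 (Y s \<omega> - a))" for \<omega>
      have "(\<integral>\<omega>. g (Suc s) \<omega> \<partial>M) \<le> (\<integral>\<omega>. g s \<omega> + K' * (\<eta> s)\<^sup>2 \<partial>M)"
      proof (rule integral_step[where w = w and W = W and t = s])
        show "w \<in> borel_measurable (F s)"
          unfolding w_def using BpF[of s] HpF[of s] Y_meas[of s] by measurable
        fix \<omega> assume \<omega>: "\<omega> \<in> space M"
        show w: "0 \<le> w \<omega> \<and> w \<omega> \<le> W"
          using Y_bounds[OF \<omega>, of s] R by (auto simp: w_def W_def max_def)
        have Ys: "Y (Suc s) \<omega> \<le> Y s \<omega> + \<xi> s \<omega>" by (rule Y_step[OF \<omega>])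
        have HS: "Hp (Suc s) \<omega> \<longleftrightarrow> Hp s \<omega> \<or> (Bp (Suc s) \<omega> \<and> a + e \<le> Y (Suc s) \<omega>)"
          using step.hyps by (auto simp: Hp_def Bp_def atLeastAtMostSuc_conv)
        have BS: "Bp (Suc s) \<omega> \<longleftrightarrow> Bp s \<omega> \<or> Y (Suc s) \<omega> \<le> a"
          using step.hyps by (auto simp: Bp_def atLeastAtMostSuc_conv)
        have \<xi>2: "(\<xi> s \<omega>)\<^sup>2 \<le> K\<^sup>2 * (\<eta> s)\<^sup>2"
          using power_mono[OF \<xi>_abs[OF \<omega>, of s], of 2] by (simp add: power_mult_distrib)
        have wK: "w \<omega> * (K * (\<eta> s)\<^sup>2) \<le> W * K * (\<eta> s)\<^sup>2"
          using w constants mult_right_mono[of "w \<omega>" W "K * (\<eta> s)\<^sup>2"] by (simp add: mult.assoc)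
        have wD: "0 \<le> w \<omega> * (2 * \<beta> * \<eta> s * D s \<omega>)"
          using w D_bounds[OF \<omega>, of s] constants \<eta>_pos[of s] by simp
        have "g (Suc s) \<omega> \<le> g s \<omega> + w \<omega> * \<xi> s \<omega> + K\<^sup>2 * (\<eta> s)\<^sup>2"
        proof (cases "Hp s \<omega>")
          case True
          then show ?thesis using HS by (simp add: g_def w_def)
        next
          case nH: False
          show ?thesis
          proof (cases "Bp s \<omega>")
            case True
            have "g (Suc s) \<omega> \<le> (max 0 (Y (Suc s) \<omega> - a))\<^sup>2"
              using e by (auto simp: g_def HS nH True BS intro!: power_mono)
            also have "\<dots> \<le> (max 0 (Y s \<omega> + \<xi> s \<omega> - a))\<^sup>2" using Ys by (intro power_mono) auto
            also have "\<dots> \<le> (max 0 (Y s \<omega> - a))\<^sup>2 + 2 * max 0 (Y s \<omega> - a) * \<xi> s \<omega> + (\<xi> s \<omega>)\<^sup>2"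
            proof (cases "Y s \<omega> \<ge> a")
              case True
              have "(max 0 (Y s \<omega> + \<xi> s \<omega> - a))\<^sup>2 \<le> (Y s \<omega> - a + \<xi> s \<omega>)\<^sup>2" by (simp add: max_def algebra_simps)
              then show ?thesis using True by (simp add: power2_sum)
            next
              case False
              have "(max 0 (Y s \<omega> + \<xi> s \<omega> - a))\<^sup>2 \<le> \<bar>\<xi> s \<omega>\<bar>\<^sup>2" using False by (intro power_mono) auto
              then show ?thesis using False by simp
            qed
            finally show ?thesis using True nH \<xi>2 by (simp add: g_def w_def)
          next
            case False
            \<comment> \<open>If the potential starts now, then \<open>Y \<le> a\<close> at this
              time and the square vanishes, so starting it adds nothing.\<close>
            have "g (Suc s) \<omega> = 0" using e False nH by (auto simp: g_def HS BS)
            then show ?thesis using False nH by (simp add: g_def w_def)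
          qed
        qed
        then show "g (Suc s) \<omega> \<le> g s \<omega> + K' * (\<eta> s)\<^sup>2
            + w \<omega> * (\<xi> s \<omega> + 2 * \<beta> * \<eta> s * D s \<omega> - K * (\<eta> s)\<^sup>2)"
          using wK wD unfolding K'_def by (simp add: algebra_simps)
      qed (use ig in auto)
      also have "\<dots> = (\<integral>\<omega>. g s \<omega> \<partial>M) + K' * (\<eta> s)\<^sup>2" using ig by (simp add: prob_space)
      finally show ?case using step by (simp add: algebra_simps)
    qed
    \<comment> \<open>Upcrossings completed within \<open>N\<close> steps; these events increase to
      \<open>U T\<close>, which carries the bound over to the infinite horizon.\<close>
    define A where "A N = {\<omega> \<in> space M. Hp (T + N) \<omega>}" for N
    have [measurable]: "A N \<in> sets M" for N unfolding A_def by measurable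
    have A_le: "prob (A N) * e\<^sup>2 \<le> K' * tail T" for N
    proof -
      have "prob (A N) * e\<^sup>2 = (\<integral>\<omega>. e\<^sup>2 * indicator (A N) \<omega> \<partial>M)" by simp
      also have "\<dots> \<le> (\<integral>\<omega>. g (T + N) \<omega> \<partial>M)"
      proof (rule integral_mono)
        show "integrable M (\<lambda>\<omega>. e\<^sup>2 * indicator (A N) \<omega>)" by (simp add: emeasure_eq_measure)
        show "integrable M (g (T + N))" by (rule ig)
      qed (auto simp: g_def A_def indicator_def)
      also have "\<dots> \<le> K' * (\<Sum>t\<in>{T..<T+N}. (\<eta> t)\<^sup>2)" by (rule int_g) simp
      also have "(\<Sum>t\<in>{T..<T+N}. (\<eta> t)\<^sup>2) = (\<Sum>t<N. (\<eta> (t + T))\<^sup>2)"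
        using sum.shift_bounds_nat_ivl[of "\<lambda>t. (\<eta> t)\<^sup>2" 0 T N] by (simp add: atLeast0LessThan add.commute)
      also have "\<dots> \<le> tail T" unfolding tail_def
        by (rule sum_le_suminf) (use \<eta>_sq_summable in \<open>auto simp: summable_iff_shift[of "\<lambda>t. (\<eta> t)\<^sup>2"]\<close>)
      finally show ?thesis using K' by (simp add: mult_left_mono)
    qed
    have "incseq A"
      unfolding incseq_def
    proof (intro allI impI subsetI)
      fix N N' \<omega> assume "N \<le> N'" "\<omega> \<in> A N"
      moreover from this have "{T..T + N} \<subseteq> {T..T + N'}" by auto
      ultimately show "\<omega> \<in> A N'" unfolding A_def Hp_def by blast
    qed
    then have "(\<lambda>N. prob (A N)) \<longlonglongrightarrow> prob (\<Union>N. A N)"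
      by (intro finite_Lim_measure_incseq) auto
    moreover have "(\<Union>N. A N) = U T"
    proof (intro equalityI subsetI)
      fix \<omega> assume "\<omega> \<in> U T"
      then obtain v u where "\<omega> \<in> space M" "u \<in> {T..v}" "Y u \<omega> \<le> a" "a + e \<le> Y v \<omega>"
        by (auto simp: U_def)
      then have "\<omega> \<in> A (v - T)"
        unfolding A_def Hp_def by (intro CollectI conjI bexI[of _ v] bexI[of _ u]) auto
      then show "\<omega> \<in> (\<Union>N. A N)" by blast
    qed (auto simp: A_def Hp_def U_def)
    ultimately have "(\<lambda>N. prob (A N) * e\<^sup>2) \<longlonglongrightarrow> prob (U T) * e\<^sup>2"
      by (intro tendsto_mult) auto
    then show ?thesis using A_le by (intro LIMSEQ_le_const2) auto
  qed
  \<comment> \<open>A path with upcrossings after every \<open>T\<close> lies in all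
    \<open>U T\<close>, whose probabilities are bounded by multiples of the tails of a convergent
    series.\<close>
  have "prob (\<Inter>T. U T) * e\<^sup>2 \<le> 0"
  proof (rule LIMSEQ_le_const)
    have "tail \<longlonglongrightarrow> 0"
      unfolding tail_def using suminf_exist_split2[OF \<eta>_sq_summable] .
    then show "(\<lambda>T. K' * tail T) \<longlonglongrightarrow> 0" using tendsto_mult_right_zero by blast
    have "prob (\<Inter>T. U T) \<le> prob (U T)" for T by (intro finite_measure_mono) auto
    then have "prob (\<Inter>T. U T) * e\<^sup>2 \<le> prob (U T) * e\<^sup>2" for T by (simp add: mult_right_mono)
    then show "\<exists>N. \<forall>T\<ge>N. prob (\<Inter>T. U T) * e\<^sup>2 \<le> K' * tail T" using main order_trans by blast
  qed
  then have "prob (\<Inter>T. U T) = 0"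
    using e by (simp add: mult_le_0_iff measure_le_0_iff)
  then have "(\<Inter>T. U T) \<in> null_sets M" by (simp add: null_setsI emeasure_eq_measure)
  then show ?thesis by (rule AE_I') (auto simp: U_def not_less)
qed

text \<open>By the pigeonhole principle some \<open>l\<close> equals \<open>Y - D\<close> at
  infinitely many times with \<open>D < e\<close>, where \<open>l \<le> Y < l + e\<close>. Absence
  of upcrossings from \<open>l + e\<close> to \<open>l + 2 * e\<close> gives the upper bound.
  Absence of those from \<open>l - 2 * e\<close> to \<open>l - e\<close> gives the lower one: a path
  that sank so low could not come back to \<open>l\<close>.\<close>

lemma eventually_near_level:
  assumes e: "0 < e" "e \<le> \<epsilon>"
  shows "AE \<omega> in M. \<exists>l\<in>L. \<exists>T. \<forall>t\<ge>T. \<bar>Y t \<omega> - l\<bar> \<le> 2 * e"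
proof -
  have "AE \<omega> in M. \<forall>l\<in>L. \<forall>a\<in>{l + e, l - 2 * e}. \<exists>T. \<forall>v. \<forall>u\<in>{T..v}. Y u \<omega> \<le> a \<longrightarrow> Y v \<omega> < a + e"
    using finite_levels no_upcrossings[OF e(1)] by (intro AE_finite_allI) auto
  moreover have "AE \<omega> in M. \<forall>T. \<exists>t\<ge>T. D t \<omega> < e" by (rule D_small_infinitely_often[OF e(1)])
  ultimately show ?thesis using AE_space
  proof eventually_elim
    case (elim \<omega>)
    let ?I = "{t. D t \<omega> < e}"
    have inf: "infinite ?I" using elim(2) unfolding infinite_nat_iff_unbounded_le by simp
    have LI: "(\<lambda>t. Y t \<omega> - D t \<omega>) ` ?I \<subseteq> L" using level_reached[OF elim(3)] e by auto
    obtain t0 where t0: "t0 \<in> ?I"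
      "infinite {t \<in> ?I. Y t \<omega> - D t \<omega> = Y t0 \<omega> - D t0 \<omega>}"
      using pigeonhole_infinite[OF inf finite_subset[OF LI finite_levels]] by blast
    define l where "l = Y t0 \<omega> - D t0 \<omega>"
    have l: "l \<in> L" using t0 LI by (auto simp: l_def)
    have io: "\<exists>t\<ge>T. D t \<omega> < e \<and> Y t \<omega> - D t \<omega> = l" for T
      using t0(2) unfolding infinite_nat_iff_unbounded_le l_def by simp
    obtain T1 where T1: "\<And>u v. T1 \<le> u \<Longrightarrow> u \<le> v \<Longrightarrow> Y u \<omega> \<le> l + e \<Longrightarrow> Y v \<omega> < l + e + e"
      using bspec[OF bspec[OF elim(1) l], of "l + e"] by fastforce
    obtain T2 where T2: "\<And>u v. T2 \<le> u \<Longrightarrow> u \<le> v \<Longrightarrow> Y u \<omega> \<le> l - 2 * e \<Longrightarrow> Y v \<omega> < l - 2 * e + e"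
      using bspec[OF bspec[OF elim(1) l], of "l - 2 * e"] by fastforce
    obtain u where u: "u \<ge> T1" "D u \<omega> < e" "Y u \<omega> - D u \<omega> = l" using io by blast
    have "\<bar>Y t \<omega> - l\<bar> \<le> 2 * e" if t: "t \<ge> max u T2" for t
    proof -
      have "Y t \<omega> < l + e + e" using T1[of u t] u t by auto
      moreover have "Y t \<omega> > l - 2 * e"
      proof (rule ccontr)
        assume "\<not> ?thesis"
        moreover obtain v where v: "v \<ge> t" "Y v \<omega> - D v \<omega> = l" using io by blast
        ultimately have "Y v \<omega> < l - 2 * e + e" using T2[of t v] t by auto
        then show False using v D_bounds[OF elim(3), of v] e by auto
      qed
      ultimately show ?thesis by auto
    qed
    then show ?case using l by blast
  qed
qed

end

subsection \<open>The rate of convergence to a level\<close>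

lemma exp_le_quadratic:
  fixes x :: real
  assumes "x \<le> 1"
  shows "exp x \<le> 1 + x + x\<^sup>2"
proof (cases "x \<ge> 0")
  case True
  then show ?thesis using assms by (rule exp_bound)
next
  case False
  define u where "u = - x"
  have u: "u > 0" using False by (simp add: u_def)
  \<comment> \<open>The product equals \<open>1 + u^3\<close>.\<close>
  have "1 \<le> (1 + u) * (1 - u + u\<^sup>2)"
    using u by (simp add: algebra_simps power2_eq_square)
  also have "\<dots> \<le> exp u * (1 - u + u\<^sup>2)"
  proof (rule mult_right_mono)
    show "1 + u \<le> exp u" by (rule exp_ge_add_one_self)
    have "0 \<le> (1 - u / 2)\<^sup>2 + 3 / 4 * u\<^sup>2" by simp
    then show "0 \<le> 1 - u + u\<^sup>2" by (simp add: power2_eq_square algebra_simps)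
  qed
  finally have "exp (- u) * 1 \<le> exp (- u) * (exp u * (1 - u + u\<^sup>2))" by (intro mult_left_mono) auto
  then show ?thesis by (simp add: u_def mult.assoc[symmetric] exp_add[symmetric])
qed

text \<open>
  The Lyapunov function for the height \<open>y\<close> above a level is \<open>\<eta> * soft_pos a (y / \<eta>)\<close>. It is
  linear above the level, where the height contracts, and decays exponentially below it, where the
  downward drift is constant.
\<close>

definition soft_pos :: "real \<Rightarrow> real \<Rightarrow> real" where
  "soft_pos a z = (if 0 \<le> z then z + 1 / a else exp (a * z) / a)"

text \<open>The derivative of \<open>soft_pos\<close>, whose two branches meet at 0 with value
  \<open>1 / a\<close> and slope 1.\<close>

definition soft_pos_deriv :: "real \<Rightarrow> real \<Rightarrow> real" where
  "soft_pos_deriv a z = (if 0 \<le> z then 1 else exp (a * z))"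

context
  fixes a :: real
  assumes a: "a > 0"
begin

lemma soft_pos_gt_0: "soft_pos a z > 0"
  using a by (auto simp: soft_pos_def add_nonneg_pos)

lemma soft_pos_deriv_bounds: "0 \<le> soft_pos_deriv a z" "soft_pos_deriv a z \<le> 1"
  using a by (auto simp: soft_pos_deriv_def mult_le_0_iff)

lemma soft_pos_mono: "z \<le> z' \<Longrightarrow> soft_pos a z \<le> soft_pos a z'"
proof -
  assume z: "z \<le> z'"
  have "exp (a * z) / a \<le> z' + 1 / a" if "z < 0" "0 \<le> z'"
  proof -
    have "exp (a * z) \<le> 1" using a that by (simp add: mult_le_0_iff)
    then have "exp (a * z) / a \<le> 1 / a" using a by (intro divide_right_mono) auto
    then show ?thesis using that by simp
  qed
  then show ?thesis using z a by (auto simp: soft_pos_def divide_right_mono)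
qed

text \<open>Lets the new, smaller step size be replaced by the old one before the increment is
  analysed. Above the level the function is \<open>y + h / a\<close>; below it, both the factor
  \<open>h\<close> and the exponent \<open>a * (y / h)\<close> grow with \<open>h\<close>.\<close>

lemma soft_pos_perspective_mono:
  assumes "0 < h" "h \<le> h'"
  shows "h * soft_pos a (y / h) \<le> h' * soft_pos a (y / h')"
proof (cases "0 \<le> y")
  case True
  have "h / a \<le> h' / a" using assms a by (intro divide_right_mono) auto
  then show ?thesis using True assms by (simp add: soft_pos_def distrib_left)
next
  case False
  then have neg: "\<not> 0 \<le> y / h" "\<not> 0 \<le> y / h'" using assms by (auto simp: zero_le_divide_iff)
  have "y / h \<le> y / h'" using assms False by (intro divide_left_mono_neg) auto
  then have "a * (y / h) \<le> a * (y / h')" using a by (intro mult_left_mono) auto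
  then have "exp (a * (y / h)) / a \<le> exp (a * (y / h')) / a"
    using a by (intro divide_right_mono) auto
  then have "h * (exp (a * (y / h)) / a) \<le> h' * (exp (a * (y / h')) / a)"
    using assms a by (intro mult_mono) auto
  then show ?thesis unfolding soft_pos_def if_not_P[OF neg(1)] if_not_P[OF neg(2)] .
qed

text \<open>A second-order expansion whose quadratic error also carries the slope as a factor. Below
  the level the slope is exponentially small and the drift is damped by it; an undamped error could
  not be compensated there.\<close>

lemma soft_pos_add_le:
  assumes x: "\<bar>a * x\<bar> \<le> 1"
  shows "soft_pos a (z + x) \<le> soft_pos a z + soft_pos_deriv a z * (x + a * x\<^sup>2)"
proof -
  have e: "exp (a * y) / a \<le> 1 / a + y + a * y\<^sup>2" if "a * y \<le> 1" for y
  proof -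
    have "exp (a * y) / a \<le> (1 + a * y + (a * y)\<^sup>2) / a"
      using exp_le_quadratic[OF that] a by (intro divide_right_mono) auto
    then show ?thesis using a by (simp add: add_divide_distrib power2_eq_square mult_ac)
  qed
  \<comment> \<open>The linear branch is the tangent at 0 of the exponential branch.\<close>
  have le_exp: "soft_pos a y \<le> exp (a * y) / a" for y
  proof -
    have "(1 + a * y) / a \<le> exp (a * y) / a" using a by (intro divide_right_mono exp_ge_add_one_self) auto
    then show ?thesis using a by (simp add: soft_pos_def add_divide_distrib add.commute)
  qed
  consider "z < 0" | "z \<ge> 0" "z + x \<ge> 0" | "z \<ge> 0" "z + x < 0" by linarith
  then show ?thesis
  proof cases
    case 1
    have "soft_pos a (z + x) \<le> exp (a * z) * (exp (a * x) / a)"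
      using le_exp[of "z + x"] by (simp add: distrib_left exp_add)
    also have "\<dots> \<le> exp (a * z) * (1 / a + x + a * x\<^sup>2)"
      using x by (intro mult_left_mono e) auto
    finally show ?thesis using 1 by (simp add: soft_pos_def soft_pos_deriv_def algebra_simps)
  next
    case 2
    then show ?thesis using a by (simp add: soft_pos_def soft_pos_deriv_def)
  next
    \<comment> \<open>On a downward crossing the exponential is expanded at 0 instead of
      \<open>z\<close>, and \<open>z + x\<close> is no larger than \<open>x\<close> in absolute
      value.\<close>
    case 3
    have "a * (z + x) \<le> 0" using 3 a by (simp add: mult_le_0_iff)
    then have "soft_pos a (z + x) \<le> 1 / a + (z + x) + a * (z + x)\<^sup>2"
      using le_exp[of "z + x"] e[of "z + x"] by linarith
    moreover have "(z + x)\<^sup>2 \<le> x\<^sup>2" using 3 by (simp add: abs_le_square_iff[symmetric])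
    then have "a * (z + x)\<^sup>2 \<le> a * x\<^sup>2" using a by simp
    ultimately show ?thesis using 3 by (simp add: soft_pos_def soft_pos_deriv_def)
  qed
qed

end

text \<open>With \<open>b = \<eta> t / a\<close>, this bounds depth times return probability by a
  term of order \<open>\<eta> t\<close>, uniformly in the depth.\<close>

lemma mult_exp_neg_le:
  fixes u :: real
  assumes "b > 0"
  shows "u * exp (- (u / b)) \<le> b"
proof -
  have "u / b \<le> exp (u / b)" using exp_ge_add_one_self[of "u / b"] by linarith
  then have "u / b * exp (- (u / b)) \<le> exp (u / b) * exp (- (u / b))" by (rule mult_right_mono) simp
  then show ?thesis using assms by (simp add: exp_add[symmetric] field_simps)
qed

text \<open>Induction with the ansatz \<open>B / (s + q)\<close>. With \<open>z = s + q\<close> the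
  step rests on \<open>(z + 1 - \<rho>) * B + (\<rho> - 1) * B = z * B\<close>: as
  \<open>\<rho> > 1\<close>, the contraction is faster than the decay of \<open>B / z\<close> and
  leaves room \<open>(\<rho> - 1) * B\<close> for the noise \<open>A\<close>. The bound
  \<open>\<rho> \<le> 1 + q\<close> keeps the contraction factor nonnegative.\<close>

lemma recursion_inverse_bound:
  fixes v :: "nat \<Rightarrow> real"
  assumes q: "q > 0" and \<rho>: "\<rho> > 1" "\<rho> \<le> 1 + q"
    and rec: "\<And>s. s \<ge> T \<Longrightarrow> v (Suc s) \<le> (1 - \<rho> / (real s + 1 + q)) * v s + A / (real s + 1 + q)\<^sup>2"
  obtains B where "\<And>s. s \<ge> T \<Longrightarrow> v s \<le> B / (real s + q)" "B \<ge> 0"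
proof -
  define B where "B = max 0 (max (A / (\<rho> - 1)) (v T * (real T + q)))"
  have B: "B \<ge> 0" "A / (\<rho> - 1) \<le> B" "v T * (real T + q) \<le> B" by (auto simp: B_def)
  have AB: "A \<le> (\<rho> - 1) * B" using B(2) \<rho> by (simp add: field_simps)
  have "v s \<le> B / (real s + q)" if "s \<ge> T" for s
    using that
  proof (induction s rule: dec_induct)
    case base
    then show ?case using B(3) q by (simp add: field_simps)
  next
    case (step s)
    define z where "z = real s + q"
    have z: "z > 0" using q by (simp add: z_def)
    have r: "\<rho> \<le> z + 1" using \<rho> by (simp add: z_def)
    have "v (Suc s) \<le> (1 - \<rho> / (z + 1)) * v s + A / (z + 1)\<^sup>2"
      using rec[OF step.hyps(1)] by (simp add: z_def add_ac)
    also have "\<dots> \<le> (1 - \<rho> / (z + 1)) * (B / z) + (\<rho> - 1) * B / (z * (z + 1))"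
    proof (rule add_mono)
      show "(1 - \<rho> / (z + 1)) * v s \<le> (1 - \<rho> / (z + 1)) * (B / z)"
        using step.IH r z by (intro mult_left_mono) (auto simp: z_def)
      have "A / (z + 1)\<^sup>2 \<le> (\<rho> - 1) * B / (z + 1)\<^sup>2" using AB by (intro divide_right_mono) auto
      also have "\<dots> \<le> (\<rho> - 1) * B / (z * (z + 1))"
        using z \<rho> B by (intro divide_left_mono mult_pos_pos) (auto simp: power2_eq_square intro: mult_right_mono)
      finally show "A / (z + 1)\<^sup>2 \<le> (\<rho> - 1) * B / (z * (z + 1))" .
    qed
    also have "(1 - \<rho> / (z + 1)) * (B / z) = (z + 1 - \<rho>) * B / (z * (z + 1))"
      using z by (simp add: field_simps)
    also have "\<dots> + (\<rho> - 1) * B / (z * (z + 1)) = z * B / (z * (z + 1))"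
      unfolding add_divide_distrib[symmetric] by (simp add: algebra_simps)
    also have "\<dots> = B / (z + 1)" using z by simp
    finally show ?case by (simp add: z_def add_ac)
  qed
  then show ?thesis using B that by blast
qed

text \<open>
  Near a level the clustering either has exactly the cost \<open>l\<close>, in which case the drift is
  proportional to the height, or \<open>D\<close> is bounded below.
\<close>

locale drift_level = drift_process +
  fixes l \<kappa> e a :: real and T0 :: nat
  assumes dichotomy: "\<omega> \<in> space M \<Longrightarrow> \<bar>Y t \<omega> - l\<bar> \<le> \<kappa> \<Longrightarrow> D t \<omega> = Y t \<omega> - l \<or> e \<le> D t \<omega>"
    and level_constants: "0 < e" "\<kappa> \<le> e / 2" "0 < a" "a * K \<le> 1" "2 * a * K\<^sup>2 \<le> \<beta> * e"
    and late: "T0 \<le> t \<Longrightarrow> 2 * K * \<eta> t \<le> \<beta> * e" "T0 \<le> t \<Longrightarrow> 2 * \<eta> t \<le> a * e"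
begin

text \<open>A budget: of the drift \<open>2 * \<beta> * \<eta> t * e\<close>, one quarter pays for
  the error \<open>K * (\<eta> t)\<^sup>2\<close>, one quarter for the second-order term of the
  potentials, and one half remains.\<close>

lemma late_drift:
  assumes "T0 \<le> t" "e \<le> D t \<omega>"
  shows "\<beta> * \<eta> t * e + a * K\<^sup>2 * \<eta> t \<le> 2 * \<beta> * \<eta> t * D t \<omega> - K * (\<eta> t)\<^sup>2"
proof -
  have "2 * \<beta> * \<eta> t * e \<le> 2 * \<beta> * \<eta> t * D t \<omega>"
    using assms constants \<eta>_pos[of t] by (intro mult_left_mono) auto
  moreover have "(2 * K * \<eta> t) * \<eta> t \<le> (\<beta> * e) * \<eta> t" "(2 * a * K\<^sup>2) * \<eta> t \<le> (\<beta> * e) * \<eta> t"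
    using late(1)[OF assms(1)] level_constants \<eta>_pos[of t] by (intro mult_right_mono; simp)+
  ultimately show ?thesis by (simp add: power2_eq_square algebra_simps)
qed

text \<open>
  Below the level \<open>l\<close> the drift is negative and of order \<open>\<eta>\<close>, so a return from depth \<open>y\<close> has
  probability at most \<open>exp (- a y / \<eta> t)\<close>.
\<close>

lemma expected_depth:
  assumes t: "T0 \<le> t"
    and G: "G \<in> sets M" "\<And>\<omega>. \<omega> \<in> G \<Longrightarrow> \<forall>s\<ge>t. \<bar>Y s \<omega> - l\<bar> \<le> \<kappa>" "\<And>\<omega>. \<omega> \<in> G \<Longrightarrow> \<exists>s\<ge>t. l \<le> Y s \<omega>"
  shows "(\<integral>\<omega>. max 0 (l - Y t \<omega>) * indicator G \<omega> \<partial>M) \<le> \<eta> t / a"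
proof -
  define H where "H s \<omega> = (\<forall>u\<in>{t..s}. l - \<kappa> \<le> Y u \<omega> \<and> Y u \<omega> < l)" for s \<omega>
  define J where "J s \<omega> = (\<exists>u\<in>{t..s}. l \<le> Y u \<omega> \<and> (\<forall>v\<in>{t..<u}. l - \<kappa> \<le> Y v \<omega> \<and> Y v \<omega> < l))" for s \<omega>
  define w0 where "w0 \<omega> = max 0 (l - Y t \<omega>)" for \<omega>
  \<comment> \<open>The initial depth times an exponential supermartingale stopped on leaving the
    strip below \<open>l\<close>: 1 after a return to \<open>l\<close>, 0 after an exit through the
    bottom. The exponent keeps the initial rate \<open>\<eta> t\<close>; later rates are smaller, so
    the bound on its increments persists.\<close>
  define g where "g s \<omega> = w0 \<omega> * (if J s \<omega> then 1 else if H s \<omega> then exp (a * (Y s \<omega> - l) / \<eta> t) else 0)" for s \<omega>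
  have w0: "0 \<le> w0 \<omega>" "\<omega> \<in> space M \<Longrightarrow> w0 \<omega> \<le> \<bar>l\<bar>" for \<omega> using Y_bounds[of \<omega> t] by (auto simp: w0_def)
  have [measurable]: "w0 \<in> borel_measurable M" unfolding w0_def by measurable
  have HF: "Measurable.pred (F s) (H s)" for s
    unfolding H_def using Y_meas_le by (intro pred_intros_finite pred_intros_logic) auto
  have JF: "Measurable.pred (F s) (J s)" for s
    unfolding J_def using Y_meas_le by (intro pred_intros_finite pred_intros_logic) auto
  have [measurable]: "Measurable.pred M (H s)" "Measurable.pred M (J s)" for s
    using measurable_from_subalg[OF subalg] HF JF by blast+
  have HnJ: "\<not> J s \<omega>" if "H s \<omega>" for s \<omega> using that by (auto simp: H_def J_def not_le[symmetric])
  have Hexp: "exp (a * (Y s \<omega> - l) / \<eta> t) \<le> 1" if "H s \<omega>" "t \<le> s" for s \<omega>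
  proof -
    have "Y s \<omega> < l" using that by (simp add: H_def)
    then show ?thesis using level_constants \<eta>_pos[of t] by (simp add: divide_le_0_iff mult_le_0_iff)
  qed
  have ig: "integrable M (g s)" if "t \<le> s" for s
  proof (rule integrable_bounded[where B = "\<bar>l\<bar>"])
    show "g s \<in> borel_measurable M" unfolding g_def by measurable
    fix \<omega> assume "\<omega> \<in> space M"
    then have "\<bar>g s \<omega>\<bar> \<le> \<bar>l\<bar> * 1"
      unfolding g_def abs_mult using w0 Hexp that by (intro mult_mono) auto
    then show "\<bar>g s \<omega>\<bar> \<le> \<bar>l\<bar>" by simp
  qed
  have dec: "(\<integral>\<omega>. g s \<omega> \<partial>M) \<le> (\<integral>\<omega>. g t \<omega> \<partial>M)" if "t \<le> s" for s
    using that
  proof (induction s rule: dec_induct)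
    case (step s)
    define z where "z \<omega> = exp (a * (Y s \<omega> - l) / \<eta> t)" for \<omega>
    define w where "w \<omega> = (if H s \<omega> then w0 \<omega> * z \<omega> * (a / \<eta> t) else 0)" for \<omega>
    have ts: "t \<le> s" by (rule step.hyps)
    have "(\<integral>\<omega>. g (Suc s) \<omega> \<partial>M) \<le> (\<integral>\<omega>. g s \<omega> \<partial>M)"
    proof (rule integral_step[where w = w and W = "\<bar>l\<bar> * 1 * (a / \<eta> t)" and t = s])
      show "w \<in> borel_measurable (F s)"
        unfolding w_def z_def w0_def using HF[of s] Y_meas[of s] Y_meas_le[OF ts] by measurable
      fix \<omega> assume \<omega>: "\<omega> \<in> space M"
      show "0 \<le> w \<omega> \<and> w \<omega> \<le> \<bar>l\<bar> * 1 * (a / \<eta> t)"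
      proof (cases "H s \<omega>")
        case True
        have "w0 \<omega> * z \<omega> \<le> \<bar>l\<bar> * 1"
          unfolding z_def using w0 \<omega> Hexp[OF True ts] by (intro mult_mono) auto
        then have "w0 \<omega> * z \<omega> * (a / \<eta> t) \<le> \<bar>l\<bar> * 1 * (a / \<eta> t)"
          using level_constants \<eta>_pos[of t] by (intro mult_right_mono) auto
        then show ?thesis
          unfolding w_def using True w0 level_constants \<eta>_pos[of t] by (simp add: z_def)
      qed (use level_constants \<eta>_pos[of t] in \<open>simp add: w_def\<close>)
      have HS: "H (Suc s) \<omega> \<longleftrightarrow> H s \<omega> \<and> l - \<kappa> \<le> Y (Suc s) \<omega> \<and> Y (Suc s) \<omega> < l"
        using ts by (auto simp: H_def atLeastAtMostSuc_conv)
      have JS: "J (Suc s) \<omega> \<longleftrightarrow> J s \<omega> \<or> H s \<omega> \<and> l \<le> Y (Suc s) \<omega>"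
        using ts by (auto simp: J_def H_def atLeastAtMostSuc_conv atLeastLessThanSuc_atLeastAtMost)
      show "g (Suc s) \<omega> \<le> g s \<omega> + w \<omega> * (\<xi> s \<omega> + 2 * \<beta> * \<eta> s * D s \<omega> - K * (\<eta> s)\<^sup>2)"
      proof (cases "H s \<omega>")
        case False
        then show ?thesis by (simp add: g_def w_def HS JS)
      next
        case True
        have eD: "e \<le> D s \<omega>"
        proof -
          have "l - \<kappa> \<le> Y s \<omega>" "Y s \<omega> < l" using True ts by (auto simp: H_def)
          then show ?thesis using dichotomy[OF \<omega>, of s] D_bounds[OF \<omega>, of s] by auto
        qed
        define x where "x = a * \<xi> s \<omega> / \<eta> t"
        have ratio: "\<eta> s \<le> \<eta> t" by (rule \<eta>_antimono[OF ts])
        have ax: "\<bar>x\<bar> \<le> a * K * \<eta> s / \<eta> t"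
          using \<xi>_abs[OF \<omega>, of s] level_constants \<eta>_pos[of t]
          by (simp add: x_def abs_mult divide_right_mono mult_left_mono mult.assoc)
        also have "a * K * \<eta> s / \<eta> t \<le> a * K * 1"
          using ratio \<eta>_pos[of t] level_constants constants unfolding times_divide_eq_right[symmetric]
          by (intro mult_left_mono) auto
        finally have x1: "x \<le> 1" using level_constants by auto
        have "x\<^sup>2 \<le> (a * K * \<eta> s / \<eta> t)\<^sup>2" using power_mono[OF ax, of 2] by simp
        also have "\<dots> = a / \<eta> t * (a * K\<^sup>2 * \<eta> s * (\<eta> s / \<eta> t))"
          by (simp add: power2_eq_square)
        also have "\<dots> \<le> a / \<eta> t * (a * K\<^sup>2 * \<eta> s * 1)"
          using ratio \<eta>_pos[of t] \<eta>_pos[of s] level_constants by (intro mult_left_mono) auto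
        also have "\<dots> \<le> a / \<eta> t * (2 * \<beta> * \<eta> s * D s \<omega> - K * (\<eta> s)\<^sup>2)"
        proof (rule mult_left_mono)
          have "0 \<le> \<beta> * \<eta> s * e" using constants \<eta>_pos[of s] level_constants by auto
          then show "a * K\<^sup>2 * \<eta> s * 1 \<le> 2 * \<beta> * \<eta> s * D s \<omega> - K * (\<eta> s)\<^sup>2"
            using late_drift[of s \<omega>] eD t ts by simp
        qed (use level_constants \<eta>_pos[of t] in auto)
        finally have x2: "x + x\<^sup>2 \<le> a / \<eta> t * (\<xi> s \<omega> + 2 * \<beta> * \<eta> s * D s \<omega> - K * (\<eta> s)\<^sup>2)"
          by (simp add: x_def algebra_simps)
        \<comment> \<open>All outcomes of the step are covered: on a return to \<open>l\<close> the
          exponential is at least 1, and on an exit through the bottom the left side is 0.\<close>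
        have "g (Suc s) \<omega> \<le> w0 \<omega> * exp (a * (Y (Suc s) \<omega> - l) / \<eta> t)"
          unfolding g_def using w0 True HnJ[OF True] level_constants \<eta>_pos[of t]
          by (intro mult_left_mono) (auto simp: HS JS)
        also have "\<dots> \<le> w0 \<omega> * exp (a * (Y s \<omega> + \<xi> s \<omega> - l) / \<eta> t)"
          using w0 Y_step[OF \<omega>, of s] level_constants \<eta>_pos[of t]
          by (intro mult_left_mono) (auto intro!: divide_right_mono mult_left_mono)
        also have "exp (a * (Y s \<omega> + \<xi> s \<omega> - l) / \<eta> t) = z \<omega> * exp x"
          by (simp add: z_def x_def exp_add[symmetric] add_divide_distrib[symmetric] algebra_simps)
        also have "w0 \<omega> * (z \<omega> * exp x) \<le> w0 \<omega> * (z \<omega> * (1 + x + x\<^sup>2))"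
          using w0 exp_le_quadratic[OF x1] by (intro mult_left_mono) (auto simp: z_def)
        also have "\<dots> = g s \<omega> + w0 \<omega> * z \<omega> * (x + x\<^sup>2)"
          using True HnJ[OF True] by (simp add: g_def z_def algebra_simps)
        also have "\<dots> \<le> g s \<omega> + w0 \<omega> * z \<omega> * (a / \<eta> t * (\<xi> s \<omega> + 2 * \<beta> * \<eta> s * D s \<omega> - K * (\<eta> s)\<^sup>2))"
          using w0 x2 by (intro add_left_mono mult_left_mono) (auto simp: z_def)
        finally show ?thesis using True by (simp add: w_def mult.assoc)
      qed
    qed (use ig ts in auto)
    then show ?case using step.IH by linarith
  qed simp
  have start: "(\<integral>\<omega>. g t \<omega> \<partial>M) \<le> \<eta> t / a"
  proof -
    have "g t \<omega> \<le> \<eta> t / a" for \<omega>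
    proof (cases "Y t \<omega> < l")
      case False
      then have "g t \<omega> = 0" by (simp add: g_def w0_def)
      then show ?thesis using \<eta>_pos[of t] level_constants by simp
    next
      case True
      have "a * (Y t \<omega> - l) = - ((l - Y t \<omega>) * a)" by (simp add: algebra_simps)
      then have ex: "a * (Y t \<omega> - l) / \<eta> t = - ((l - Y t \<omega>) / (\<eta> t / a))" by simp
      have "g t \<omega> \<le> (l - Y t \<omega>) * exp (- ((l - Y t \<omega>) / (\<eta> t / a)))"
        unfolding g_def w0_def ex[symmetric] using True
        by (intro mult_mono) (auto simp: J_def)
      also have "\<dots> \<le> \<eta> t / a" using \<eta>_pos[of t] level_constants by (intro mult_exp_neg_le) auto
      finally show ?thesis .
    qed
    then have "(\<integral>\<omega>. g t \<omega> \<partial>M) \<le> (\<integral>\<omega>. \<eta> t / a \<partial>M)" using ig by (intro integral_mono) auto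
    then show ?thesis by (simp add: prob_space)
  qed
  have [measurable]: "G \<in> sets M" by (rule G)
  \<comment> \<open>Here the future-dependent \<open>G\<close> enters: on it the path reaches
    \<open>l\<close> without leaving the band, so \<open>J s\<close> holds eventually and the
    finite-horizon bounds pass to the limit.\<close>
  have lim: "(\<lambda>s. \<integral>\<omega>. w0 \<omega> * indicator G \<omega> * of_bool (J s \<omega>) \<partial>M)
      \<longlonglongrightarrow> (\<integral>\<omega>. w0 \<omega> * indicator G \<omega> \<partial>M)"
  proof (rule integral_dominated_convergence[where w = "\<lambda>_. \<bar>l\<bar>"])
    show "AE \<omega> in M. (\<lambda>s. w0 \<omega> * indicator G \<omega> * of_bool (J s \<omega>)) \<longlonglongrightarrow> w0 \<omega> * indicator G \<omega>"
    proof (rule AE_I2)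
      fix \<omega> assume \<omega>: "\<omega> \<in> space M"
      show "(\<lambda>s. w0 \<omega> * indicator G \<omega> * of_bool (J s \<omega>)) \<longlonglongrightarrow> w0 \<omega> * indicator G \<omega>"
      proof (cases "\<omega> \<in> G")
        case True
        define u where "u = (LEAST s. t \<le> s \<and> l \<le> Y s \<omega>)"
        have u: "t \<le> u" "l \<le> Y u \<omega>"
          using LeastI_ex[of "\<lambda>s. t \<le> s \<and> l \<le> Y s \<omega>"] G(3)[OF True] by (auto simp: u_def)
        have "l - \<kappa> \<le> Y v \<omega> \<and> Y v \<omega> < l" if "v \<in> {t..<u}" for v
        proof -
          have "Y v \<omega> < l"
            using that not_less_Least[of v "\<lambda>s. t \<le> s \<and> l \<le> Y s \<omega>"] by (auto simp: u_def)
          moreover have "\<bar>Y v \<omega> - l\<bar> \<le> \<kappa>" using G(2)[OF True] that by auto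
          ultimately show ?thesis by auto
        qed
        then have "J s \<omega>" if "s \<ge> u" for s unfolding J_def using u that by (intro bexI[of _ u]) auto
        then have "eventually (\<lambda>s. w0 \<omega> * indicator G \<omega> * of_bool (J s \<omega>) = w0 \<omega> * indicator G \<omega>) sequentially"
          unfolding eventually_sequentially by auto
        then show ?thesis by (rule tendsto_eventually)
      qed simp
    qed
    show "AE \<omega> in M. norm (w0 \<omega> * indicator G \<omega> * of_bool (J s \<omega>)) \<le> \<bar>l\<bar>" for s
      by (rule AE_I2) (use w0 in \<open>auto simp: indicator_def\<close>)
  qed auto
  have "(\<integral>\<omega>. w0 \<omega> * indicator G \<omega> * of_bool (J s \<omega>) \<partial>M) \<le> \<eta> t / a" if "t \<le> s" for s
  proof -
    have "(\<integral>\<omega>. w0 \<omega> * indicator G \<omega> * of_bool (J s \<omega>) \<partial>M) \<le> (\<integral>\<omega>. g s \<omega> \<partial>M)"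
    proof (rule integral_mono)
      show "integrable M (\<lambda>\<omega>. w0 \<omega> * indicator G \<omega> * of_bool (J s \<omega>))"
        by (rule integrable_bounded[where B = "\<bar>l\<bar>"]) (use w0 in \<open>auto simp: indicator_def\<close>)
      show "w0 \<omega> * indicator G \<omega> * of_bool (J s \<omega>) \<le> g s \<omega>" for \<omega>
        using w0 by (auto simp: g_def indicator_def)
    qed (rule ig[OF that])
    then show ?thesis using dec[OF that] start by linarith
  qed
  then have "(\<integral>\<omega>. w0 \<omega> * indicator G \<omega> \<partial>M) \<le> \<eta> t / a"
    by (intro LIMSEQ_le_const2[OF lim]) auto
  then show ?thesis by (simp add: w0_def)
qed

text \<open>\<open>G\<close> lies in the adapted event \<open>E s\<close> of staying in the band
  from \<open>T\<close> to \<open>s\<close>, and the potential \<open>V\<close> dominates the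
  positive part of the height. Killing \<open>V\<close> on leaving the band only lowers it, so its
  mean obeys a recursion without reference to \<open>G\<close>; hence one \<open>B\<close> serves
  all \<open>G\<close>.\<close>

lemma expected_height:
  assumes T: "T0 \<le> T"
  shows "\<exists>B\<ge>0. \<forall>t\<ge>T. \<forall>G\<in>sets M. (\<forall>\<omega>\<in>G. \<forall>s\<ge>T. \<bar>Y s \<omega> - l\<bar> \<le> \<kappa>) \<longrightarrow>
    (\<integral>\<omega>. max 0 (Y t \<omega> - l) * indicator G \<omega> \<partial>M) \<le> B / (real t + q)"
proof -
  define E where "E s \<omega> = (\<forall>u\<in>{T..s}. \<bar>Y u \<omega> - l\<bar> \<le> \<kappa>)" for s \<omega>
  define V where "V s \<omega> = \<eta> s * soft_pos a ((Y s \<omega> - l) / \<eta> s)" for s \<omega>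
  define g where "g s \<omega> = (if E s \<omega> then V s \<omega> else 0)" for s \<omega>
  \<comment> \<open>Above the level \<open>V\<close> contains the summand
    \<open>\<eta> s / a\<close>, on which the drift does not act although the recursion contracts
    it; \<open>\<beta> / a\<close> makes up for this.\<close>
  define K' where "K' = K + \<beta> / a"
  have a: "a > 0" using level_constants by simp
  have EF: "Measurable.pred (F s) (E s)" for s
    unfolding E_def using Y_meas_le by (intro pred_intros_finite) auto
  have [measurable]: "Measurable.pred M (E s)" for s
    using measurable_from_subalg[OF subalg] EF by blast
  have V_pos: "V s \<omega> > 0" for s \<omega> unfolding V_def using \<eta>_pos soft_pos_gt_0[OF a] by simp
  have V_le: "V s \<omega> \<le> \<kappa> + \<eta> s / a" if "\<bar>Y s \<omega> - l\<bar> \<le> \<kappa>" for s \<omega>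
  proof -
    have "(Y s \<omega> - l) / \<eta> s \<le> \<kappa> / \<eta> s" using that \<eta>_pos[of s] by (intro divide_right_mono) auto
    then have "V s \<omega> \<le> \<eta> s * soft_pos a (\<kappa> / \<eta> s)"
      unfolding V_def using \<eta>_pos[of s] soft_pos_mono[OF a] by (intro mult_left_mono) auto
    also have "\<dots> = \<kappa> + \<eta> s / a" using that \<eta>_pos[of s] by (simp add: soft_pos_def distrib_left)
    finally show ?thesis .
  qed
  have V_ge: "Y s \<omega> - l \<le> V s \<omega>" for s \<omega>
  proof (cases "Y s \<omega> \<ge> l")
    case True
    then show ?thesis using \<eta>_pos[of s] a by (simp add: V_def soft_pos_def distrib_left)
  qed (use V_pos[of s \<omega>] in simp)
  have ig: "integrable M (g s)" if "T \<le> s" for s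
  proof (rule integrable_bounded[where B = "\<bar>\<kappa>\<bar> + \<eta> s / a"])
    show "g s \<in> borel_measurable M" unfolding g_def V_def soft_pos_def by measurable
    have "E s \<omega> \<Longrightarrow> V s \<omega> \<le> \<bar>\<kappa>\<bar> + \<eta> s / a" for \<omega>
      using V_le[of s \<omega>] that by (auto simp: E_def)
    then show "\<bar>g s \<omega>\<bar> \<le> \<bar>\<kappa>\<bar> + \<eta> s / a" for \<omega>
      using V_pos[of s \<omega>] \<eta>_pos[of s] a by (auto simp: g_def)
  qed
  have rec: "(\<integral>\<omega>. g (Suc s) \<omega> \<partial>M) \<le> (1 - \<beta> * \<eta> s) * (\<integral>\<omega>. g s \<omega> \<partial>M) + K' * (\<eta> s)\<^sup>2" if s: "T \<le> s" for s
  proof -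
    define w where "w \<omega> = (if E s \<omega> then soft_pos_deriv a ((Y s \<omega> - l) / \<eta> s) else 0)" for \<omega>
    have "(\<integral>\<omega>. g (Suc s) \<omega> \<partial>M) \<le> (\<integral>\<omega>. (1 - \<beta> * \<eta> s) * g s \<omega> + K' * (\<eta> s)\<^sup>2 \<partial>M)"
    proof (rule integral_step[where w = w and W = 1 and t = s])
      show "w \<in> borel_measurable (F s)"
        unfolding w_def soft_pos_deriv_def using EF[of s] Y_meas[of s] by measurable
      fix \<omega> assume \<omega>: "\<omega> \<in> space M"
      show "0 \<le> w \<omega> \<and> w \<omega> \<le> 1" using soft_pos_deriv_bounds[OF a] by (auto simp: w_def)
      have K': "0 \<le> K' * (\<eta> s)\<^sup>2" using constants a by (simp add: K'_def)
      have ES: "E (Suc s) \<omega> \<Longrightarrow> E s \<omega>" using s by (auto simp: E_def)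
      show "g (Suc s) \<omega> \<le> (1 - \<beta> * \<eta> s) * g s \<omega> + K' * (\<eta> s)\<^sup>2
          + w \<omega> * (\<xi> s \<omega> + 2 * \<beta> * \<eta> s * D s \<omega> - K * (\<eta> s)\<^sup>2)"
      proof (cases "E s \<omega>")
        case False
        then have "g (Suc s) \<omega> = 0" using ES by (auto simp: g_def)
        then show ?thesis using False K' by (simp add: g_def w_def)
      next
        case True
        define y where "y = Y s \<omega> - l"
        define h where "h = \<eta> s"
        define d where "d = soft_pos_deriv a (y / h)"
        have h: "h > 0" using \<eta>_pos by (simp add: h_def)
        have yk: "\<bar>y\<bar> \<le> \<kappa>" using True s by (auto simp: E_def y_def)
        have d: "0 \<le> d" "d \<le> 1" using soft_pos_deriv_bounds[OF a] by (auto simp: d_def)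
        have "g (Suc s) \<omega> \<le> V (Suc s) \<omega>" using V_pos[of "Suc s" \<omega>] by (auto simp: g_def)
        also have "\<dots> \<le> h * soft_pos a ((Y (Suc s) \<omega> - l) / h)"
          unfolding V_def h_def by (rule soft_pos_perspective_mono[OF a \<eta>_pos \<eta>_antimono]) simp
        also have "\<dots> \<le> h * soft_pos a ((y + \<xi> s \<omega>) / h)"
        proof (intro mult_left_mono soft_pos_mono[OF a] divide_right_mono)
          show "Y (Suc s) \<omega> - l \<le> y + \<xi> s \<omega>" using Y_step[OF \<omega>, of s] by (simp add: y_def)
        qed (use h in auto)
        finally have g1: "g (Suc s) \<omega> \<le> h * soft_pos a ((y + \<xi> s \<omega>) / h)" .
        have gs: "g s \<omega> = h * soft_pos a (y / h)" using True by (simp add: g_def V_def y_def h_def)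
        have ws: "w \<omega> = d" using True by (simp add: w_def d_def y_def h_def)
        have goal: "g (Suc s) \<omega> \<le> (1 - \<beta> * h) * g s \<omega> + K' * h\<^sup>2
          + d * (\<xi> s \<omega> + 2 * \<beta> * h * D s \<omega> - K * h\<^sup>2)"
          using dichotomy[OF \<omega> yk[unfolded y_def]]
        proof
          \<comment> \<open>Since \<open>\<xi> \<ge> - D = - y\<close>, the sum
            \<open>y + \<xi>\<close> stays nonnegative: only the linear branch of the potential is
            met.\<close>
          assume D: "D s \<omega> = Y s \<omega> - l"
          then have y0: "y \<ge> 0" "y + \<xi> s \<omega> \<ge> 0" "D s \<omega> = y"
            using D_bounds[OF \<omega>, of s] \<xi>_ge[OF \<omega>, of s] by (auto simp: y_def)
          have d1: "d = 1" using y0 h by (simp add: d_def soft_pos_deriv_def)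
          have "h * soft_pos a ((y + \<xi> s \<omega>) / h) = y + \<xi> s \<omega> + h / a"
            using y0 h a by (simp add: soft_pos_def field_simps)
          moreover have "g s \<omega> = y + h / a" using y0 h unfolding gs by (simp add: soft_pos_def distrib_left)
          moreover have "0 \<le> \<beta> * h * y" using constants h y0 by auto
          ultimately show ?thesis using g1 unfolding d1 y0(3) K'_def
            by (simp add: algebra_simps power2_eq_square)
        next
          assume eD: "e \<le> D s \<omega>"
          define x where "x = \<xi> s \<omega> / h"
          have hx: "\<xi> s \<omega> = h * x" using h by (simp add: x_def)
          have "\<bar>h * x\<bar> \<le> K * h" using \<xi>_abs[OF \<omega>, of s] by (simp add: hx h_def)
          then have xK: "\<bar>x\<bar> \<le> K" using h by (simp add: abs_mult mult.commute)
          have "a * \<bar>x\<bar> \<le> 1" using mult_left_mono[OF xK, of a] level_constants by linarith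
          then have ax: "\<bar>a * x\<bar> \<le> 1" using a by (simp add: abs_mult)
          have x2: "x\<^sup>2 \<le> K\<^sup>2" using power_mono[OF xK, of 2] by simp
          have "h * soft_pos a ((y + \<xi> s \<omega>) / h) = h * soft_pos a (y / h + x)"
            by (simp add: x_def add_divide_distrib)
          also have "\<dots> \<le> h * (soft_pos a (y / h) + d * (x + a * x\<^sup>2))"
            unfolding d_def using h by (intro mult_left_mono soft_pos_add_le[OF a ax]) auto
          also have "\<dots> \<le> h * (soft_pos a (y / h) + d * (x + a * K\<^sup>2))"
            using h d a x2 by (intro mult_left_mono add_left_mono) auto
          also have "\<dots> = g s \<omega> + d * (\<xi> s \<omega> + a * K\<^sup>2 * h)"
            by (simp add: gs hx algebra_simps)
          finally have g2: "g (Suc s) \<omega> \<le> g s \<omega> + d * (\<xi> s \<omega> + a * K\<^sup>2 * h)" using g1 by linarith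
          \<comment> \<open>This turns the remaining drift, slope times
            \<open>\<beta> * h * e\<close>, into a contraction by \<open>\<beta> * h\<close>. Above
            the level, \<open>\<kappa> \<le> e / 2\<close> and \<open>h / a \<le> e / 2\<close> add
            up to \<open>e\<close>; below it the potential is \<open>h / a\<close> times the
            slope.\<close>
          have gd: "g s \<omega> \<le> d * e"
          proof -
            have ha: "h / a \<le> e / 2" using late(2)[of s] T s a by (simp add: h_def field_simps)
            show ?thesis
            proof (cases "y \<ge> 0")
              case True
              then have "g s \<omega> = y + h / a" "d * e = e"
                using h unfolding gs d_def by (auto simp: soft_pos_def soft_pos_deriv_def distrib_left)
              then show ?thesis using ha yk level_constants(2) by linarith
            next
              case False
              then have "g s \<omega> = d * (h / a)"
                using h unfolding gs d_def
                by (auto simp: soft_pos_def soft_pos_deriv_def zero_le_divide_iff)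
              moreover have "d * (h / a) \<le> d * e"
                using ha d level_constants(1) by (intro mult_left_mono) linarith+
              ultimately show ?thesis by simp
            qed
          qed
          then have "\<beta> * h * g s \<omega> \<le> \<beta> * h * (d * e)" using constants h by (intro mult_left_mono) auto
          moreover have "d * (\<beta> * h * e + a * K\<^sup>2 * h) \<le> d * (2 * \<beta> * h * D s \<omega> - K * h\<^sup>2)"
            using late_drift[of s \<omega>] eD T s d unfolding h_def by (intro mult_left_mono) auto
          moreover have "0 \<le> K' * h\<^sup>2" using K' by (simp add: h_def)
          ultimately show ?thesis using g2 by (simp add: algebra_simps)
        qed
        then show ?thesis by (simp add: ws h_def)
      qed
    qed (use ig s in auto)
    also have "\<dots> = (1 - \<beta> * \<eta> s) * (\<integral>\<omega>. g s \<omega> \<partial>M) + K' * (\<eta> s)\<^sup>2"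
      using ig[OF s] by (simp add: prob_space)
    finally show ?thesis .
  qed
  obtain B where B: "\<And>s. s \<ge> T \<Longrightarrow> (\<integral>\<omega>. g s \<omega> \<partial>M) \<le> B / (real s + q)" "B \<ge> 0"
  proof (rule recursion_inverse_bound[where v = "\<lambda>s. \<integral>\<omega>. g s \<omega> \<partial>M" and \<rho> = "\<beta> * c" and q = q
        and T = T and A = "K' * c\<^sup>2"])
    show "\<beta> * c \<le> 1 + q" using constants c_gt_1 mult_right_mono[of \<beta> 1 c] by linarith
    show "(\<integral>\<omega>. g (Suc s) \<omega> \<partial>M) \<le> (1 - \<beta> * c / (real s + 1 + q)) * (\<integral>\<omega>. g s \<omega> \<partial>M)
        + K' * c\<^sup>2 / (real s + 1 + q)\<^sup>2" if "T \<le> s" for s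
      using rec[OF that] by (simp add: \<eta> power_divide)
  qed (use q_pos constants in auto)
  have "(\<integral>\<omega>. max 0 (Y t \<omega> - l) * indicator G \<omega> \<partial>M) \<le> B / (real t + q)"
    if t: "t \<ge> T" and G: "G \<in> sets M" "\<forall>\<omega>\<in>G. \<forall>s\<ge>T. \<bar>Y s \<omega> - l\<bar> \<le> \<kappa>" for t G
  proof -
    note [measurable] = G(1)
    have "(\<integral>\<omega>. max 0 (Y t \<omega> - l) * indicator G \<omega> \<partial>M) \<le> (\<integral>\<omega>. g t \<omega> \<partial>M)"
    proof (rule integral_mono)
      show "integrable M (\<lambda>\<omega>. max 0 (Y t \<omega> - l) * indicator G \<omega>)"
      proof (rule integrable_bounded[where B = "R + \<bar>l\<bar>"])
        show "\<bar>max 0 (Y t \<omega> - l) * indicator G \<omega>\<bar> \<le> R + \<bar>l\<bar>" if "\<omega> \<in> space M" for \<omega>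
          using Y_bounds[OF that, of t] by (auto simp: indicator_def max_def)
      qed measurable
      show "max 0 (Y t \<omega> - l) * indicator G \<omega> \<le> g t \<omega>" for \<omega>
        using V_ge[of t \<omega>] V_pos[of t \<omega>] G(2) by (auto simp: g_def E_def indicator_def)
    qed (rule ig[OF t])
    then show ?thesis using B(1)[OF t] by linarith
  qed
  then show ?thesis using B(2) by blast
qed

end

section \<open>All levels at once\<close>

context drift_process
begin

lemma levels_separated:
  obtains g where "g > 0" "\<And>l l'. l \<in> L \<Longrightarrow> l' \<in> L \<Longrightarrow> \<bar>l - l'\<bar> < g \<Longrightarrow> l = l'"
proof -
  define Q where "Q = insert 1 ((\<lambda>(l, l'). \<bar>l - l'\<bar>) ` (L \<times> L) - {0})"
  have Q: "finite Q" "\<And>x. x \<in> Q \<Longrightarrow> x > 0" using finite_levels by (auto simp: Q_def)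
  have "Min Q \<le> \<bar>l - l'\<bar>" if "l \<in> L" "l' \<in> L" "l \<noteq> l'" for l l'
    using Q that by (intro Min_le) (auto simp: Q_def)
  moreover have "Min Q > 0" using Q by (auto simp: Q_def)
  ultimately show ?thesis using that[of "Min Q"] by fastforce
qed

text \<open>The events of being trapped from time \<open>T\<close> on increase to an almost sure
  event, so one deterministic \<open>T\<close> works up to probability
  \<open>\<delta>\<close>.\<close>

theorem convergence_to_levels:
  assumes \<delta>: "\<delta> > 0"
  shows "\<exists>G. (\<forall>l\<in>L. G l \<in> sets M) \<and> prob (\<Union>l\<in>L. G l) \<ge> 1 - \<delta> \<and>
    (\<forall>l\<in>L. \<exists>B. \<forall>t\<ge>1. (\<integral>\<omega>. \<bar>Y t \<omega> - l\<bar> * indicator (G l) \<omega> \<partial>M) \<le> B / real t)"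
proof -
  obtain g where g: "g > 0" "\<And>l l'. l \<in> L \<Longrightarrow> l' \<in> L \<Longrightarrow> \<bar>l - l'\<bar> < g \<Longrightarrow> l = l'"
    using levels_separated by metis
  \<comment> \<open>In the band of width \<open>\<kappa> = e / 2\<close> around \<open>l\<close>, a
    state with \<open>D < e\<close> has \<open>Y - D\<close> within \<open>3 * e / 2 < g\<close> of
    \<open>l\<close>, so the level it reaches is \<open>l\<close> itself.\<close>
  define e where "e = min \<epsilon> (g / 4)"
  define \<kappa> where "\<kappa> = e / 2"
  \<comment> \<open>The first entry lets one step move the exponent by at most 1; the second makes
    the drift beat the second-order term of the potentials.\<close>
  define a where "a = min (1 / K) (\<beta> * e / (2 * K\<^sup>2))"
  have e: "0 < e" "e \<le> \<epsilon>" "e \<le> g / 4" using \<epsilon> g by (auto simp: e_def)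
  have a0: "a > 0" using constants e by (auto simp: a_def)
  have "a \<le> 1 / K" "a \<le> \<beta> * e / (2 * K\<^sup>2)" by (auto simp: a_def)
  then have a1: "a * K \<le> 1" "2 * a * K\<^sup>2 \<le> \<beta> * e" using constants by (auto simp: field_simps)
  have "(\<lambda>t. 2 * K * \<eta> t) \<longlonglongrightarrow> 0" "(\<lambda>t. 2 * \<eta> t) \<longlonglongrightarrow> 0"
    by (intro tendsto_mult_right_zero \<eta>_tendsto)+
  then have "eventually (\<lambda>t. 2 * K * \<eta> t < \<beta> * e) sequentially" "eventually (\<lambda>t. 2 * \<eta> t < a * e) sequentially"
    using constants e a0 order_tendstoD(2)[of _ 0] by (metis mult_pos_pos)+
  then have "eventually (\<lambda>t. 2 * K * \<eta> t < \<beta> * e \<and> 2 * \<eta> t < a * e) sequentially"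
    by (rule eventually_conj)
  then obtain T0 where T0: "\<And>t. T0 \<le> t \<Longrightarrow> 2 * K * \<eta> t < \<beta> * e \<and> 2 * \<eta> t < a * e"
    unfolding eventually_sequentially by blast
  have level: "drift_level M F Y D \<xi> L \<epsilon> \<beta> R K c q \<eta> l \<kappa> e a T0" if l: "l \<in> L" for l
  proof (intro drift_level.intro drift_level_axioms.intro)
    show "drift_process M F Y D \<xi> L \<epsilon> \<beta> R K c q \<eta>" by (rule drift_process_axioms)
    fix t \<omega> assume \<omega>: "\<omega> \<in> space M" and k: "\<bar>Y t \<omega> - l\<bar> \<le> \<kappa>"
    show "D t \<omega> = Y t \<omega> - l \<or> e \<le> D t \<omega>"
    proof (cases "D t \<omega> < e")
      case True
      then have "Y t \<omega> - D t \<omega> \<in> L" using level_reached[OF \<omega>, of t] e by auto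
      moreover have "\<bar>Y t \<omega> - D t \<omega> - l\<bar> < g"
        using k[unfolded \<kappa>_def] True conjunct1[OF D_bounds[OF \<omega>, of t]] e by linarith
      ultimately have "Y t \<omega> - D t \<omega> = l" using g(2) l by blast
      then show ?thesis by simp
    qed auto
  qed (use e a0 a1 T0 in \<open>auto simp: \<kappa>_def intro: less_imp_le\<close>)
  \<comment> \<open>The second condition forces returns, as the depth bound requires: inside the
    band, \<open>D < e\<close> means \<open>D = Y - l\<close>, hence
    \<open>l \<le> Y\<close>.\<close>
  define G where "G T l = {\<omega> \<in> space M. (\<forall>t\<ge>T. \<bar>Y t \<omega> - l\<bar> \<le> \<kappa>) \<and> (\<forall>N. \<exists>t\<ge>N. D t \<omega> < e)}" for T l
  have G_meas [measurable]: "G T l \<in> sets M" for T l unfolding G_def by measurable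
  define U where "U T = (\<Union>l\<in>L. G T l)" for T
  have U_meas [measurable]: "U T \<in> sets M" for T
    unfolding U_def using finite_levels by (intro sets.finite_UN) auto
  have "AE \<omega> in M. \<exists>l\<in>L. \<exists>T. \<forall>t\<ge>T. \<bar>Y t \<omega> - l\<bar> \<le> 2 * (e / 4)"
    using e by (intro eventually_near_level) auto
  moreover have "AE \<omega> in M. \<forall>N. \<exists>t\<ge>N. D t \<omega> < e" by (rule D_small_infinitely_often[OF e(1)])
  ultimately have "AE \<omega> in M. \<omega> \<in> (\<Union>T. U T)"
    using AE_space by eventually_elim (auto simp: U_def G_def \<kappa>_def)
  then have "prob (\<Union>T. U T) = 1" by (subst prob_eq_1) auto
  moreover have "incseq U"
    unfolding incseq_def U_def
  proof (intro allI impI UN_mono order_refl)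
    show "G m l \<subseteq> G n l" if "m \<le> n" for m n l using that unfolding G_def by auto
  qed
  then have "(\<lambda>T. prob (U T)) \<longlonglongrightarrow> prob (\<Union>T. U T)"
    by (intro finite_Lim_measure_incseq) auto
  ultimately have "eventually (\<lambda>T. 1 - \<delta> < prob (U T)) sequentially"
    using \<delta> by (intro order_tendstoD(1)[where y = 1]) auto
  then obtain T where T: "T \<ge> T0" "1 - \<delta> < prob (U T)"
    unfolding eventually_sequentially by (meson nle_le)
  have "\<exists>B. \<forall>t\<ge>1. (\<integral>\<omega>. \<bar>Y t \<omega> - l\<bar> * indicator (G T l) \<omega> \<partial>M) \<le> B / real t" if l: "l \<in> L" for l
  proof -
    interpret drift_level M F Y D \<xi> L \<epsilon> \<beta> R K c q \<eta> l \<kappa> e a T0 by (rule level[OF l])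
    have band: "\<forall>\<omega>\<in>G T l. \<forall>s\<ge>T. \<bar>Y s \<omega> - l\<bar> \<le> \<kappa>" by (auto simp: G_def)
    obtain B where B: "B \<ge> 0" and height: "\<forall>t\<ge>T. \<forall>G\<in>sets M. (\<forall>\<omega>\<in>G. \<forall>s\<ge>T. \<bar>Y s \<omega> - l\<bar> \<le> \<kappa>) \<longrightarrow>
        (\<integral>\<omega>. max 0 (Y t \<omega> - l) * indicator G \<omega> \<partial>M) \<le> B / (real t + q)"
      using expected_height[OF T(1)] by (elim exE conjE)
    have above: "\<exists>s\<ge>t. l \<le> Y s \<omega>" if "\<omega> \<in> G T l" "t \<ge> T" for \<omega> t
    proof -
      have "\<forall>N. \<exists>t\<ge>N. D t \<omega> < e" using that(1) by (simp add: G_def)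
      then obtain s where s: "s \<ge> t" "D s \<omega> < e" by blast
      have \<omega>: "\<omega> \<in> space M" using that by (auto simp: G_def)
      have "\<bar>Y s \<omega> - l\<bar> \<le> \<kappa>" using that s band by auto
      then have "l \<le> Y s \<omega>" using dichotomy[OF \<omega>, of s] s D_bounds[OF \<omega>, of s] by auto
      then show ?thesis using s by blast
    qed
    have R: "R \<ge> 0" using Y_bounds not_empty by fastforce
    have abs_le: "\<bar>Y t \<omega> - l\<bar> \<le> R + \<bar>l\<bar>" if "\<omega> \<in> space M" for t \<omega> using Y_bounds[OF that, of t] by auto
    have int: "integrable M (\<lambda>\<omega>. h (Y t \<omega> - l) * indicator (G T l) \<omega>)"
      if "h \<in> borel_measurable borel" "\<And>x. \<bar>h x\<bar> \<le> \<bar>x\<bar>" for h :: "real \<Rightarrow> real" and t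
    proof (rule integrable_bounded[where B = "R + \<bar>l\<bar>"])
      note [measurable] = that(1)
      show "(\<lambda>\<omega>. h (Y t \<omega> - l) * indicator (G T l) \<omega>) \<in> borel_measurable M" by measurable
      show "\<bar>h (Y t \<omega> - l) * indicator (G T l) \<omega>\<bar> \<le> R + \<bar>l\<bar>" if "\<omega> \<in> space M" for \<omega>
        using order_trans[OF \<open>\<And>x. \<bar>h x\<bar> \<le> \<bar>x\<bar>\<close> abs_le[OF that]] R by (auto simp: indicator_def)
    qed
    have late_bound: "(\<integral>\<omega>. \<bar>Y t \<omega> - l\<bar> * indicator (G T l) \<omega> \<partial>M) \<le> (B + c / a) / real t"
      if t: "t \<ge> T" "t \<ge> 1" for t
    proof -
      have "(\<integral>\<omega>. \<bar>Y t \<omega> - l\<bar> * indicator (G T l) \<omega> \<partial>M)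
          = (\<integral>\<omega>. max 0 (Y t \<omega> - l) * indicator (G T l) \<omega> + max 0 (l - Y t \<omega>) * indicator (G T l) \<omega> \<partial>M)"
        by (rule Bochner_Integration.integral_cong) (auto simp: indicator_def)
      also have "\<dots> = (\<integral>\<omega>. max 0 (Y t \<omega> - l) * indicator (G T l) \<omega> \<partial>M)
          + (\<integral>\<omega>. max 0 (l - Y t \<omega>) * indicator (G T l) \<omega> \<partial>M)"
        using int[of "\<lambda>x. max 0 x" t] int[of "\<lambda>x. max 0 (- x)" t] by simp
      also have "\<dots> \<le> B / (real t + q) + \<eta> t / a"
      proof (rule add_mono)
        show "(\<integral>\<omega>. max 0 (l - Y t \<omega>) * indicator (G T l) \<omega> \<partial>M) \<le> \<eta> t / a"
          using T t band above by (intro expected_depth) auto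
        show "(\<integral>\<omega>. max 0 (Y t \<omega> - l) * indicator (G T l) \<omega> \<partial>M) \<le> B / (real t + q)"
          using height t(1) G_meas band by (meson)
      qed
      also have "\<dots> \<le> B / real t + (c / real t) / a"
        using t B q_pos a0 \<eta>_le[OF t(2)] by (intro add_mono divide_left_mono divide_right_mono) auto
      also have "\<dots> = (B + c / a) / real t" by (simp add: add_divide_distrib)
      finally show ?thesis .
    qed
    \<comment> \<open>Before \<open>T\<close> only the trivial bound is used, and the factor
      \<open>real T / real t \<ge> 1\<close> gives it the desired form.\<close>
    have early_bound: "(\<integral>\<omega>. \<bar>Y t \<omega> - l\<bar> * indicator (G T l) \<omega> \<partial>M) \<le> (R + \<bar>l\<bar>) * real T / real t"
      if t: "t < T" "t \<ge> 1" for t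
    proof -
      have "(\<integral>\<omega>. \<bar>Y t \<omega> - l\<bar> * indicator (G T l) \<omega> \<partial>M) \<le> (\<integral>\<omega>. R + \<bar>l\<bar> \<partial>M)"
        using int[of abs t] abs_le[of _ t] R by (intro integral_mono) (auto simp: indicator_def)
      also have "\<dots> = (R + \<bar>l\<bar>) * 1" by (simp add: prob_space)
      also have "\<dots> \<le> (R + \<bar>l\<bar>) * (real T / real t)" using t R by (intro mult_left_mono) auto
      finally show ?thesis by simp
    qed
    show ?thesis
    proof (intro exI allI impI)
      fix t :: nat assume t: "1 \<le> t"
      have p: "0 \<le> B + c / a" "0 \<le> (R + \<bar>l\<bar>) * real T" using B c_gt_1 a0 R by auto
      show "(\<integral>\<omega>. \<bar>Y t \<omega> - l\<bar> * indicator (G T l) \<omega> \<partial>M) \<le> ((B + c / a) + (R + \<bar>l\<bar>) * real T) / real t"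
      proof (cases "t \<ge> T")
        case True
        have "(B + c / a) / real t \<le> ((B + c / a) + (R + \<bar>l\<bar>) * real T) / real t"
          using p by (intro divide_right_mono) auto
        then show ?thesis using late_bound[OF True t] by linarith
      next
        case False
        have "(R + \<bar>l\<bar>) * real T / real t \<le> ((B + c / a) + (R + \<bar>l\<bar>) * real T) / real t"
          using p by (intro divide_right_mono) auto
        then show ?thesis using early_bound[of t] False t by linarith
      qed
    qed
  qed
  then show ?thesis using G_meas T(2) unfolding U_def by (intro exI[of _ "G T"]) auto
qed

end

subsection \<open>Stochastic k-means\<close>

text \<open>Turns mini-batches and assignments into random elements of finite function spaces, so
  that their values can be treated one by one.\<close>

lemma measurable_restrict_count_space:
  assumes A: "finite A" and B: "finite B"
    and f: "\<And>x. x \<in> A \<Longrightarrow> (\<lambda>\<omega>. f \<omega> x) \<in> N \<rightarrow>\<^sub>M count_space B"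
  shows "(\<lambda>\<omega>. restrict (f \<omega>) A) \<in> N \<rightarrow>\<^sub>M count_space (PiE A (\<lambda>_. B))"
  unfolding measurable_count_space_eq2[OF finite_PiE[OF A B]]
proof (intro conjI ballI)
  show "(\<lambda>\<omega>. restrict (f \<omega>) A) \<in> space N \<rightarrow> PiE A (\<lambda>_. B)"
    using measurable_space[OF f] by (auto simp: PiE_iff)
  fix g assume g: "g \<in> PiE A (\<lambda>_. B)"
  have eq: "restrict (f \<omega>) A = g \<longleftrightarrow> (\<forall>x\<in>A. f \<omega> x = g x)" for \<omega>
    using g by (auto simp: restrict_def PiE_def extensional_def fun_eq_iff)
  have "{\<omega> \<in> space N. \<forall>x\<in>A. f \<omega> x = g x} \<in> sets N"
  proof (rule sets.sets_Collect_finite_All[OF _ A])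
    fix x assume x: "x \<in> A"
    have "(\<lambda>\<omega>. f \<omega> x) -` {g x} \<inter> space N \<in> sets N"
      by (rule measurable_sets[OF f[OF x]]) (use g x in auto)
    then show "{\<omega> \<in> space N. f \<omega> x = g x} \<in> sets N" by (simp add: vimage_def Int_def conj_commute)
  qed
  then show "(\<lambda>\<omega>. restrict (f \<omega>) A) -` {g} \<inter> space N \<in> sets N"
    by (simp add: vimage_def Int_def conj_commute eq)
qed

section \<open>Boundedness and adaptedness of the centroids\<close>

locale kmeans_run = stochastic_kmeans M F X k m "\<lambda>r. h" c0 S a C
  for M :: "'w measure" and F :: "nat \<Rightarrow> 'w measure"
    and X :: "'a::euclidean_space set" and k m :: nat and h :: "nat \<Rightarrow> real"
    and c0 :: "nat \<Rightarrow> 'a" and S :: "nat \<Rightarrow> nat \<Rightarrow> 'w \<Rightarrow> 'a"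
    and a :: "nat \<Rightarrow> 'w \<Rightarrow> 'a \<Rightarrow> nat" and C :: "nat \<Rightarrow> 'w \<Rightarrow> nat \<Rightarrow> 'a" +
  fixes \<rho> :: real
  assumes X: "finite X" "X \<noteq> {}" and \<rho>: "\<rho> > 0" "\<And>x. x \<in> X \<Longrightarrow> norm x \<le> \<rho>"
    and c0_bound: "\<And>r. r < k \<Longrightarrow> norm (c0 r) \<le> \<rho>"
    and h: "\<And>t. 0 < h t" "\<And>t. h t \<le> 1"
    and m: "m \<ge> 1"
begin

text \<open>Indexed by the time at which it is known: the assignment of iteration
  \<open>t + 1\<close> is measurable for \<open>F t\<close>, whereas \<open>batch t\<close>, drawn
  in the same iteration, is measurable for \<open>F (Suc t)\<close>.\<close>

definition asg :: "nat \<Rightarrow> 'w \<Rightarrow> 'a \<Rightarrow> nat" where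
  "asg t \<omega> = restrict (a (Suc t) \<omega>) X"

definition batch :: "nat \<Rightarrow> 'w \<Rightarrow> nat \<Rightarrow> 'a" where
  "batch t \<omega> = restrict (\<lambda>i. S (Suc t) i \<omega>) {..<m}"

definition disp :: "nat \<Rightarrow> 'w \<Rightarrow> (nat \<Rightarrow> 'a) \<Rightarrow> nat \<Rightarrow> 'a" where
  "disp t \<omega> xs r = displacement m (asg t \<omega>) (C t \<omega>) xs r"

lemma disp_empty: "{i. i < m \<and> asg t \<omega> (xs i) = r} = {} \<Longrightarrow> disp t \<omega> xs r = 0"
  by (simp add: disp_def displacement_def)

lemma disp_nonempty:
  "{i. i < m \<and> asg t \<omega> (xs i) = r} \<noteq> {} \<Longrightarrow> disp t \<omega> xs r =
    (\<Sum>i\<in>{i. i < m \<and> asg t \<omega> (xs i) = r}. xs i) /\<^sub>R real (card {i. i < m \<and> asg t \<omega> (xs i) = r}) - C t \<omega> r"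
  unfolding disp_def displacement_def Let_def by (rule if_not_P)

abbreviation batches :: "(nat \<Rightarrow> 'a) set" where "batches \<equiv> PiE {..<m} (\<lambda>_. X)"

abbreviation assignments :: "('a \<Rightarrow> nat) set" where "assignments \<equiv> PiE X (\<lambda>_. {..<k})"

lemma finite_batches: "finite batches" and finite_assignments: "finite assignments"
  using X by (auto intro: finite_PiE)

lemma asg_measurable: "asg t \<in> F t \<rightarrow>\<^sub>M count_space assignments"
  unfolding asg_def using X assign_measurable by (intro measurable_restrict_count_space) auto

lemma batch_measurable: "batch t \<in> F (Suc t) \<rightarrow>\<^sub>M count_space batches"
  unfolding batch_def using X sample_measurable by (intro measurable_restrict_count_space) auto

lemma asg_in: "\<omega> \<in> space M \<Longrightarrow> asg t \<omega> \<in> assignments"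
  using measurable_space[OF asg_measurable, of \<omega> t] space_F by auto

lemma asg_less: "\<omega> \<in> space M \<Longrightarrow> x \<in> X \<Longrightarrow> asg t \<omega> x < k"
  using asg_in by fastforce

lemma batch_in: "\<omega> \<in> space M \<Longrightarrow> batch t \<omega> \<in> batches"
  using measurable_space[OF batch_measurable, of \<omega> t] space_F by auto

lemma asg_nearest: "\<omega> \<in> space M \<Longrightarrow> nearest X {..<k} (C t \<omega>) (asg t \<omega>)"
  using assign_nearest[of \<omega> t] by (simp add: nearest_def asg_def)

lemma C_Suc:
  assumes \<omega>: "\<omega> \<in> space M" and r: "r < k"
  shows "C (Suc t) \<omega> r = C t \<omega> r + h (Suc t) *\<^sub>R disp t \<omega> (batch t \<omega>) r"
proof -
  have "S (Suc t) i \<omega> \<in> X" if "i < m" for i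
    using measurable_space[OF sample_measurable[OF that, of t], of \<omega>] \<omega> space_F by auto
  then have I: "{i. i < m \<and> asg t \<omega> (batch t \<omega> i) = r} = {i. i < m \<and> a (Suc t) \<omega> (S (Suc t) i \<omega>) = r}"
    by (auto simp: asg_def batch_def)
  have "(\<Sum>i\<in>{i. i < m \<and> a (Suc t) \<omega> (S (Suc t) i \<omega>) = r}. batch t \<omega> i)
      = (\<Sum>i\<in>{i. i < m \<and> a (Suc t) \<omega> (S (Suc t) i \<omega>) = r}. S (Suc t) i \<omega>)"
    by (rule sum.cong) (auto simp: batch_def)
  then show ?thesis
    unfolding step[OF \<omega> r] disp_def displacement_def I Let_def
    by (simp only: if_distrib[where f = "\<lambda>y. C t \<omega> r + h (Suc t) *\<^sub>R y"] scaleR_zero_right add_0_right cong: if_cong)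
      (simp only: scaleR_diff_left scaleR_diff_right scaleR_one algebra_simps)
qed

lemma norm_batch_mean:
  assumes "xs \<in> batches" "I \<subseteq> {..<m}" "I \<noteq> {}"
  shows "norm ((\<Sum>i\<in>I. xs i) /\<^sub>R real (card I)) \<le> \<rho>"
proof -
  have I: "finite I" using assms finite_subset by blast
  have "norm (\<Sum>i\<in>I. xs i) \<le> (\<Sum>i\<in>I. \<rho>)"
    using assms \<rho>(2) by (intro sum_norm_le) (auto simp: PiE_iff)
  then show ?thesis using I assms(3) by (simp add: field_simps card_gt_0_iff)
qed

text \<open>Rates at most 1 make each update a convex combination of points of the ball.\<close>

lemma C_bound: "\<omega> \<in> space M \<Longrightarrow> r < k \<Longrightarrow> norm (C t \<omega> r) \<le> \<rho>"
proof (induction t)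
  case 0
  then show ?case using init c0_bound by simp
next
  case (Suc t)
  let ?I = "{i. i < m \<and> asg t \<omega> (batch t \<omega> i) = r}"
  show ?case
  proof (cases "?I = {}")
    case True
    then show ?thesis using Suc C_Suc[of \<omega> r t] by (simp add: disp_empty)
  next
    case False
    define b where "b = (\<Sum>i\<in>?I. batch t \<omega> i) /\<^sub>R real (card ?I)"
    have b: "norm b \<le> \<rho>" unfolding b_def
      using False batch_in[OF Suc.prems(1)] by (intro norm_batch_mean) auto
    have "C (Suc t) \<omega> r = (1 - h (Suc t)) *\<^sub>R C t \<omega> r + h (Suc t) *\<^sub>R b"
      unfolding C_Suc[OF Suc.prems, of t] disp_nonempty[OF False] b_def[symmetric] by (simp add: algebra_simps)
    then have "norm (C (Suc t) \<omega> r) \<le> norm ((1 - h (Suc t)) *\<^sub>R C t \<omega> r) + norm (h (Suc t) *\<^sub>R b)"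
      by (simp only: norm_triangle_ineq)
    also have "\<dots> = (1 - h (Suc t)) * norm (C t \<omega> r) + h (Suc t) * norm b"
      using h[of "Suc t"] by simp
    also have "\<dots> \<le> (1 - h (Suc t)) * \<rho> + h (Suc t) * \<rho>"
      using Suc b h[of "Suc t"] by (intro add_mono mult_left_mono) auto
    finally show ?thesis by (simp add: algebra_simps)
  qed
qed

lemma disp_bound:
  assumes "\<omega> \<in> space M" "r < k" "xs \<in> batches"
  shows "norm (disp t \<omega> xs r) \<le> 2 * \<rho>"
proof (cases "{i. i < m \<and> asg t \<omega> (xs i) = r} = {}")
  case True
  then show ?thesis using \<rho> by (simp add: disp_empty)
next
  case False
  let ?b = "(\<Sum>i\<in>{i. i < m \<and> asg t \<omega> (xs i) = r}. xs i) /\<^sub>R real (card {i. i < m \<and> asg t \<omega> (xs i) = r})"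
  have "norm ?b \<le> \<rho>" using False assms by (intro norm_batch_mean) auto
  moreover have "disp t \<omega> xs r = ?b - C t \<omega> r" by (rule disp_nonempty[OF False])
  ultimately show ?thesis
    using C_bound[OF assms(1,2), of t] norm_triangle_ineq4[of ?b "C t \<omega> r"] by simp
qed

text \<open>Fixing each of the finitely many assignments first removes the random index in terms
  such as \<open>C t \<omega> (asg t \<omega> x)\<close>.\<close>

lemma measurable_asg_dependent:
  assumes "\<And>\<alpha>. \<alpha> \<in> assignments \<Longrightarrow> f \<alpha> \<in> F t \<rightarrow>\<^sub>M N"
  shows "(\<lambda>\<omega>. f (asg t \<omega>) \<omega>) \<in> F t \<rightarrow>\<^sub>M N"
  by (rule measurable_compose_countable'[OF assms asg_measurable countable_finite[OF finite_assignments]])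

lemma F_mono: "f \<in> F s \<rightarrow>\<^sub>M N \<Longrightarrow> s \<le> t \<Longrightarrow> f \<in> F t \<rightarrow>\<^sub>M N"
  using sets_F_mono[of s t] space_F[of s] space_F[of t] by (auto simp: measurable_def)

lemma C_measurable: "r < k \<Longrightarrow> (\<lambda>\<omega>. C t \<omega> r) \<in> borel_measurable (F t)"
proof (induction t)
  case 0
  have "(\<lambda>\<omega>. c0 r) \<in> borel_measurable (F 0)" by simp
  then show ?case
    by (rule measurable_cong[THEN iffD1, rotated]) (use init 0 space_F in auto)
next
  case (Suc t)
  have "(\<lambda>\<omega>. displacement m \<alpha> (C t \<omega>) xs r) \<in> borel_measurable (F t)" for \<alpha> xs
    unfolding displacement_def Let_def using Suc by auto
  then have "(\<lambda>\<omega>. disp t \<omega> xs r) \<in> borel_measurable (F t)" for xs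
    unfolding disp_def by (rule measurable_asg_dependent)
  then have "(\<lambda>\<omega>. disp t \<omega> xs r) \<in> borel_measurable (F (Suc t))" for xs
    by (rule F_mono) simp
  then have "(\<lambda>\<omega>. disp t \<omega> (batch t \<omega>) r) \<in> borel_measurable (F (Suc t))"
    by (rule measurable_compose_countable'[OF _ batch_measurable countable_finite[OF finite_batches]])
  moreover have "(\<lambda>\<omega>. C t \<omega> r) \<in> borel_measurable (F (Suc t))"
    by (rule F_mono[OF Suc.IH[OF Suc.prems]]) simp
  ultimately have "(\<lambda>\<omega>. C t \<omega> r + h (Suc t) *\<^sub>R disp t \<omega> (batch t \<omega>) r) \<in> borel_measurable (F (Suc t))"
    by measurable
  then show ?case
    by (rule measurable_cong[THEN iffD1, rotated]) (use C_Suc Suc space_F in auto)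
qed

lemma disp_measurable: "r < k \<Longrightarrow> (\<lambda>\<omega>. disp t \<omega> xs r) \<in> borel_measurable (F t)"
  unfolding disp_def
  by (rule measurable_asg_dependent) (unfold displacement_def Let_def, use C_measurable in auto)

text \<open>\<open>sample_uniform\<close>, read over all sets of \<open>F t\<close>, says that the
  conditional expectation of the indicator is the constant \<open>1 / real (card X) ^ m\<close>; the
  known factor \<open>f\<close> can then be pulled out.\<close>

lemma integral_given_batch:
  fixes f :: "'w \<Rightarrow> real"
  assumes f: "f \<in> borel_measurable (F t)" "\<And>\<omega>. \<omega> \<in> space M \<Longrightarrow> \<bar>f \<omega>\<bar> \<le> B" and xs: "xs \<in> batches"
  shows "(\<integral>\<omega>. f \<omega> * indicator {\<omega> \<in> space M. batch t \<omega> = xs} \<omega> \<partial>M)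
       = (\<integral>\<omega>. f \<omega> \<partial>M) / real (card X) ^ m"
proof -
  interpret finite_measure_subalgebra M "F t"
    by (intro finite_measure_subalgebra.intro finite_measure_subalgebra_axioms.intro subalg)
      (rule finite_measure_axioms)
  define A where "A = {\<omega> \<in> space M. batch t \<omega> = xs}"
  have A: "A = {\<omega> \<in> space M. \<forall>i<m. S (Suc t) i \<omega> = xs i}"
    using xs by (auto simp: A_def batch_def restrict_def PiE_def extensional_def fun_eq_iff)
  have "batch t -` {xs} \<inter> space (F (Suc t)) \<in> sets (F (Suc t))"
    by (rule measurable_sets[OF batch_measurable]) (use xs in auto)
  moreover have "batch t -` {xs} \<inter> space (F (Suc t)) = A" by (auto simp: A_def space_F)
  ultimately have A_meas [measurable]: "A \<in> sets M"
    using stochastic_kmeans.subalg[OF stochastic_kmeans_axioms, of "Suc t"] by (auto simp: subalgebra_def)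
  have fM [measurable]: "f \<in> borel_measurable M" using measurable_from_subalg[OF subalg f(1)] .
  have int: "integrable M f" using f fM by (intro integrable_const_bound[where B = B]) auto
  have c: "AE \<omega> in M. real_cond_exp M (F t) (indicator A) \<omega> = 1 / real (card X) ^ m"
  proof (rule real_cond_exp_charact)
    fix B assume B: "B \<in> sets (F t)"
    then have BM [measurable]: "B \<in> sets M" using subalg by (auto simp: subalgebra_def)
    have "(\<integral>\<omega>\<in>B. indicator A \<omega> \<partial>M) = (\<integral>\<omega>. indicator (B \<inter> A) \<omega> \<partial>M)"
      unfolding set_lebesgue_integral_def
      by (rule Bochner_Integration.integral_cong) (auto simp: indicator_def)
    also have "\<dots> = prob (B \<inter> A)" using A_meas BM by simp
    also have "\<dots> = prob B * (1 / real (card X)) ^ m"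
      unfolding A using sample_uniform[OF B, of xs] xs by (auto simp: PiE_iff)
    also have "\<dots> = (\<integral>\<omega>\<in>B. 1 / real (card X) ^ m \<partial>M)"
      using BM by (simp add: set_lebesgue_integral_def power_divide)
    finally show "(\<integral>\<omega>\<in>B. indicator A \<omega> \<partial>M) = (\<integral>\<omega>\<in>B. 1 / real (card X) ^ m \<partial>M)" .
  qed (auto simp: emeasure_eq_measure)
  have "(\<integral>\<omega>. f \<omega> * indicator A \<omega> \<partial>M) = (\<integral>\<omega>. f \<omega> * real_cond_exp M (F t) (indicator A) \<omega> \<partial>M)"
    by (rule real_cond_exp_intg(2)[symmetric]) (use f(1) int in \<open>auto intro: integrable_real_mult_indicator\<close>)
  also have "\<dots> = (\<integral>\<omega>. f \<omega> * (1 / real (card X) ^ m) \<partial>M)"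
    by (rule integral_cong_AE) (use c in auto)
  finally show ?thesis by (simp add: A_def)
qed

lemma integral_over_batch:
  fixes g :: "'w \<Rightarrow> (nat \<Rightarrow> 'a) \<Rightarrow> real"
  assumes g: "\<And>xs. xs \<in> batches \<Longrightarrow> (\<lambda>\<omega>. g \<omega> xs) \<in> borel_measurable (F t)"
    and b: "\<And>xs \<omega>. xs \<in> batches \<Longrightarrow> \<omega> \<in> space M \<Longrightarrow> \<bar>g \<omega> xs\<bar> \<le> B"
  shows "(\<integral>\<omega>. g \<omega> (batch t \<omega>) \<partial>M) = (\<integral>\<omega>. (\<Sum>xs\<in>batches. g \<omega> xs) / real (card X) ^ m \<partial>M)"
proof -
  let ?i = "\<lambda>xs. indicator {\<omega> \<in> space M. batch t \<omega> = xs}"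
  have gM [measurable]: "(\<lambda>\<omega>. g \<omega> xs) \<in> borel_measurable M" if "xs \<in> batches" for xs
    using measurable_from_subalg[OF subalg g[OF that]] .
  have int: "integrable M (\<lambda>\<omega>. g \<omega> xs)" if "xs \<in> batches" for xs
    using that b gM by (intro integrable_const_bound[where B = B]) auto
  have A: "{\<omega> \<in> space M. batch t \<omega> = xs} \<in> sets M" if "xs \<in> batches" for xs
  proof -
    have "batch t -` {xs} \<inter> space (F (Suc t)) \<in> sets (F (Suc t))"
      by (rule measurable_sets[OF batch_measurable]) (use that in auto)
    moreover have "batch t -` {xs} \<inter> space (F (Suc t)) = {\<omega> \<in> space M. batch t \<omega> = xs}"
      by (auto simp: space_F)
    ultimately show ?thesis using subalg[of "Suc t"] by (auto simp: subalgebra_def)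
  qed
  have "(\<integral>\<omega>. g \<omega> (batch t \<omega>) \<partial>M) = (\<integral>\<omega>. (\<Sum>xs\<in>batches. g \<omega> xs * ?i xs \<omega>) \<partial>M)"
  proof (rule Bochner_Integration.integral_cong)
    fix \<omega> assume \<omega>: "\<omega> \<in> space M"
    have "(\<Sum>xs\<in>batches. g \<omega> xs * ?i xs \<omega>) = (\<Sum>xs\<in>batches. if xs = batch t \<omega> then g \<omega> xs else 0)"
      using \<omega> by (intro sum.cong) (auto simp: indicator_def)
    then show "g \<omega> (batch t \<omega>) = (\<Sum>xs\<in>batches. g \<omega> xs * ?i xs \<omega>)"
      using finite_batches batch_in[OF \<omega>] by (simp add: sum.delta)
  qed simp
  also have "\<dots> = (\<Sum>xs\<in>batches. \<integral>\<omega>. g \<omega> xs * ?i xs \<omega> \<partial>M)"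
    using int A by (intro Bochner_Integration.integral_sum integrable_real_mult_indicator) auto
  also have "\<dots> = (\<Sum>xs\<in>batches. (\<integral>\<omega>. g \<omega> xs \<partial>M) / real (card X) ^ m)"
    using integral_given_batch[OF g b] by (intro sum.cong) auto
  also have "\<dots> = (\<integral>\<omega>. (\<Sum>xs\<in>batches. g \<omega> xs) / real (card X) ^ m \<partial>M)"
    using int by (simp add: sum_divide_distrib[symmetric])
  finally show ?thesis .
qed

section \<open>The drift of the k-means cost\<close>

definition cost :: "nat \<Rightarrow> 'w \<Rightarrow> real" where
  "cost t \<omega> = kcost X (C t \<omega> ` {..<k})"

definition gap :: "nat \<Rightarrow> 'w \<Rightarrow> real" where
  "gap t \<omega> = (\<Sum>x\<in>X. (norm (C t \<omega> (asg t \<omega> x) - centre X (asg t \<omega>) x))\<^sup>2)"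

text \<open>Keeps the old assignment after the centroids have moved, which makes it a quadratic
  polynomial in the displacements; the reassignment that follows can only lower the cost
  further.\<close>

definition change :: "nat \<Rightarrow> 'w \<Rightarrow> real" where
  "change t \<omega> = (\<Sum>x\<in>X. (norm (x - C (Suc t) \<omega> (asg t \<omega> x)))\<^sup>2) - cost t \<omega>"

lemma cost_eq: "\<omega> \<in> space M \<Longrightarrow> cost t \<omega> = (\<Sum>x\<in>X. (norm (x - C t \<omega> (asg t \<omega> x)))\<^sup>2)"
  unfolding cost_def by (rule kcost_nearest[OF asg_nearest]) auto

lemma cost_minus_gap:
  "\<omega> \<in> space M \<Longrightarrow> cost t \<omega> - gap t \<omega> = (\<Sum>x\<in>X. (norm (x - centre X (asg t \<omega>) x))\<^sup>2)"
  unfolding cost_eq gap_def by (subst pythagoras_clusters[OF X(1)]) simp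

lemma cost_measurable: "cost t \<in> borel_measurable (F t)"
proof -
  have "(\<lambda>\<omega>. \<Sum>x\<in>X. (norm (x - C t \<omega> (asg t \<omega> x)))\<^sup>2) \<in> borel_measurable (F t)"
  proof (intro measurable_asg_dependent[where f = "\<lambda>\<alpha> \<omega>. \<Sum>x\<in>X. (norm (x - C t \<omega> (\<alpha> x)))\<^sup>2"] borel_measurable_sum)
    fix \<alpha> x assume "\<alpha> \<in> assignments" "x \<in> X"
    then have [measurable]: "(\<lambda>\<omega>. C t \<omega> (\<alpha> x)) \<in> borel_measurable (F t)" by (intro C_measurable) auto
    show "(\<lambda>\<omega>. (norm (x - C t \<omega> (\<alpha> x)))\<^sup>2) \<in> borel_measurable (F t)" by measurable
  qed
  then show ?thesis
    by (rule measurable_cong[THEN iffD1, rotated]) (use cost_eq space_F in auto)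
qed

lemma gap_measurable: "gap t \<in> borel_measurable (F t)"
  unfolding gap_def
proof (intro measurable_asg_dependent[where f = "\<lambda>\<alpha> \<omega>. \<Sum>x\<in>X. (norm (C t \<omega> (\<alpha> x) - centre X \<alpha> x))\<^sup>2"] borel_measurable_sum)
  fix \<alpha> x assume "\<alpha> \<in> assignments" "x \<in> X"
  then have [measurable]: "(\<lambda>\<omega>. C t \<omega> (\<alpha> x)) \<in> borel_measurable (F t)" by (intro C_measurable) auto
  show "(\<lambda>\<omega>. (norm (C t \<omega> (\<alpha> x) - centre X \<alpha> x))\<^sup>2) \<in> borel_measurable (F t)" by measurable
qed

lemma change_measurable: "change t \<in> borel_measurable M"
proof -
  have "(\<lambda>\<omega>. \<Sum>x\<in>X. (norm (x - C (Suc t) \<omega> (asg t \<omega> x)))\<^sup>2) \<in> borel_measurable (F (Suc t))"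
  proof (rule measurable_compose_countable'[where I = assignments and g = "asg t"
        and f = "\<lambda>\<alpha> \<omega>. \<Sum>x\<in>X. (norm (x - C (Suc t) \<omega> (\<alpha> x)))\<^sup>2"])
    show "asg t \<in> F (Suc t) \<rightarrow>\<^sub>M count_space assignments" by (rule F_mono[OF asg_measurable]) simp
    show "countable assignments" using finite_assignments by (rule countable_finite)
    fix \<alpha> assume \<alpha>: "\<alpha> \<in> assignments"
    show "(\<lambda>\<omega>. \<Sum>x\<in>X. (norm (x - C (Suc t) \<omega> (\<alpha> x)))\<^sup>2) \<in> borel_measurable (F (Suc t))"
    proof (rule borel_measurable_sum)
      fix x assume "x \<in> X"
      then have [measurable]: "(\<lambda>\<omega>. C (Suc t) \<omega> (\<alpha> x)) \<in> borel_measurable (F (Suc t))"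
        using \<alpha> by (intro C_measurable) auto
      show "(\<lambda>\<omega>. (norm (x - C (Suc t) \<omega> (\<alpha> x)))\<^sup>2) \<in> borel_measurable (F (Suc t))" by measurable
    qed
  qed
  then show ?thesis
    unfolding change_def using measurable_from_subalg[OF subalg] cost_measurable
    by (intro borel_measurable_diff) auto
qed

lemma dist_bound: "\<omega> \<in> space M \<Longrightarrow> x \<in> X \<Longrightarrow> norm (x - C t \<omega> (asg t \<omega> x)) \<le> 2 * \<rho>"
  using C_bound[of \<omega> "asg t \<omega> x" t] asg_less[of \<omega> x t] \<rho>(2)[of x] norm_triangle_ineq4[of x "C t \<omega> (asg t \<omega> x)"]
  by simp

lemma change_eq:
  assumes \<omega>: "\<omega> \<in> space M"
  shows "change t \<omega> = (\<Sum>x\<in>X. (h (Suc t))\<^sup>2 * (norm (disp t \<omega> (batch t \<omega>) (asg t \<omega> x)))\<^sup>2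
    - 2 * h (Suc t) * ((x - C t \<omega> (asg t \<omega> x)) \<bullet> disp t \<omega> (batch t \<omega>) (asg t \<omega> x)))"
proof -
  have "(norm (x - C (Suc t) \<omega> (asg t \<omega> x)))\<^sup>2 - (norm (x - C t \<omega> (asg t \<omega> x)))\<^sup>2
      = (h (Suc t))\<^sup>2 * (norm (disp t \<omega> (batch t \<omega>) (asg t \<omega> x)))\<^sup>2
    - 2 * h (Suc t) * ((x - C t \<omega> (asg t \<omega> x)) \<bullet> disp t \<omega> (batch t \<omega>) (asg t \<omega> x))" if x: "x \<in> X" for x
    unfolding C_Suc[OF \<omega> asg_less[OF \<omega> x]] power2_norm_eq_inner
    by (simp add: inner_diff_left inner_diff_right inner_add_left inner_add_right inner_commute
        power2_eq_square algebra_simps)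
  then show ?thesis unfolding change_def cost_eq[OF \<omega>] sum_subtractf[symmetric] by (intro sum.cong) auto
qed

text \<open>Per data point: displacements and distances are at most \<open>2 * \<rho>\<close>, so
  the quadratic term contributes \<open>4 * \<rho>\<^sup>2\<close> and the cross term
  \<open>8 * \<rho>\<^sup>2\<close>.\<close>

definition "bound = 12 * real (card X) * \<rho>\<^sup>2"

lemma bound_pos: "bound > 0"
  using X \<rho> by (simp add: bound_def card_gt_0_iff)

lemma change_abs:
  assumes \<omega>: "\<omega> \<in> space M"
  shows "\<bar>change t \<omega>\<bar> \<le> bound * h (Suc t)"
proof -
  let ?h = "h (Suc t)"
  let ?d = "\<lambda>x. disp t \<omega> (batch t \<omega>) (asg t \<omega> x)"
  have "\<bar>change t \<omega>\<bar> \<le> (\<Sum>x\<in>X. 12 * \<rho>\<^sup>2 * ?h)"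
    unfolding change_eq[OF \<omega>]
  proof (rule order_trans[OF sum_abs sum_mono])
    fix x assume x: "x \<in> X"
    have d: "norm (?d x) \<le> 2 * \<rho>" by (rule disp_bound[OF \<omega> asg_less[OF \<omega> x] batch_in[OF \<omega>]])
    have "\<bar>(x - C t \<omega> (asg t \<omega> x)) \<bullet> ?d x\<bar> \<le> (2 * \<rho>) * (2 * \<rho>)"
      using Cauchy_Schwarz_ineq2[of "x - C t \<omega> (asg t \<omega> x)" "?d x"]
        mult_mono[OF dist_bound[OF \<omega> x, of t] d] \<rho> by auto
    then have 1: "\<bar>2 * ?h * ((x - C t \<omega> (asg t \<omega> x)) \<bullet> ?d x)\<bar> \<le> 2 * ?h * ((2 * \<rho>) * (2 * \<rho>))"
      using h[of "Suc t"] by (simp add: abs_mult)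
    have "?h\<^sup>2 * (norm (?d x))\<^sup>2 \<le> ?h * (2 * \<rho>)\<^sup>2"
      using h[of "Suc t"] power_mono[OF d, of 2] by (intro mult_mono) (auto simp: power2_eq_square mult_le_one)
    moreover have "0 \<le> ?h\<^sup>2 * (norm (?d x))\<^sup>2" by simp
    ultimately show "\<bar>?h\<^sup>2 * (norm (?d x))\<^sup>2 - 2 * ?h * ((x - C t \<omega> (asg t \<omega> x)) \<bullet> ?d x)\<bar> \<le> 12 * \<rho>\<^sup>2 * ?h"
      using 1 by (simp add: power2_eq_square abs_le_iff algebra_simps)
  qed
  also have "\<dots> = bound * ?h" by (simp add: bound_def)
  finally show ?thesis .
qed

text \<open>Up to the factor \<open>- 2 * h (Suc t)\<close>, the first-order part of
  \<open>change\<close>, as a function of an arbitrary batch so that it can be averaged with the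
  past frozen.\<close>

definition pull :: "nat \<Rightarrow> 'w \<Rightarrow> (nat \<Rightarrow> 'a) \<Rightarrow> real" where
  "pull t \<omega> xs = (\<Sum>x\<in>X. (x - C t \<omega> (asg t \<omega> x)) \<bullet> disp t \<omega> xs (asg t \<omega> x))"

lemma pull_abs: "\<omega> \<in> space M \<Longrightarrow> xs \<in> batches \<Longrightarrow> \<bar>pull t \<omega> xs\<bar> \<le> real (card X) * (4 * \<rho>\<^sup>2)"
proof -
  assume \<omega>: "\<omega> \<in> space M" and xs: "xs \<in> batches"
  have "\<bar>pull t \<omega> xs\<bar> \<le> (\<Sum>x\<in>X. 4 * \<rho>\<^sup>2)"
    unfolding pull_def
  proof (rule order_trans[OF sum_abs sum_mono])
    fix x assume x: "x \<in> X"
    show "\<bar>(x - C t \<omega> (asg t \<omega> x)) \<bullet> disp t \<omega> xs (asg t \<omega> x)\<bar> \<le> 4 * \<rho>\<^sup>2"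
      using Cauchy_Schwarz_ineq2[of "x - C t \<omega> (asg t \<omega> x)" "disp t \<omega> xs (asg t \<omega> x)"]
        mult_mono[OF dist_bound[OF \<omega> x, of t] disp_bound[OF \<omega> asg_less[OF \<omega> x] xs, of t t]] \<rho>
      by (auto simp: power2_eq_square)
  qed
  then show ?thesis by simp
qed

lemma pull_measurable: "(\<lambda>\<omega>. pull t \<omega> xs) \<in> borel_measurable (F t)"
  unfolding pull_def
proof (intro measurable_asg_dependent[where f = "\<lambda>\<alpha> \<omega>. \<Sum>x\<in>X. (x - C t \<omega> (\<alpha> x)) \<bullet> disp t \<omega> xs (\<alpha> x)"] borel_measurable_sum)
  fix \<alpha> x assume "\<alpha> \<in> assignments" "x \<in> X"
  then have [measurable]: "(\<lambda>\<omega>. C t \<omega> (\<alpha> x)) \<in> borel_measurable (F t)"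
    "(\<lambda>\<omega>. disp t \<omega> xs (\<alpha> x)) \<in> borel_measurable (F t)" by (auto intro!: C_measurable disp_measurable)
  show "(\<lambda>\<omega>. (x - C t \<omega> (\<alpha> x)) \<bullet> disp t \<omega> xs (\<alpha> x)) \<in> borel_measurable (F t)" by measurable
qed

definition hit :: real where "hit = 1 - exp (- real m / real (card X))"

text \<open>Both sides are sums over clusters. By \<open>sum_displacement\<close> the average
  displacement in direction \<open>u r\<close> is its squared norm times the fraction of batches
  that hit the cluster, and \<open>hit\<close> is a lower bound for this fraction if the cluster is
  nonempty. Empty clusters have weight 0.\<close>

lemma mean_pull:
  assumes \<omega>: "\<omega> \<in> space M"
  shows "hit * gap t \<omega> \<le> (\<Sum>xs\<in>batches. pull t \<omega> xs) / real (card X) ^ m"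
proof -
  define P where "P r = cluster X (asg t \<omega>) r" for r
  define u where "u r = mean (P r) - C t \<omega> r" for r
  define n where "n = real (card X)"
  have n: "n > 0" using X by (simp add: n_def card_gt_0_iff)
  have P: "finite (P r)" "P r \<subseteq> X" for r using X by (auto simp: P_def cluster_def)
  have img: "asg t \<omega> ` X \<subseteq> {..<k}" using asg_less[OF \<omega>] by auto
  have split: "(\<Sum>x\<in>X. f x) = (\<Sum>r<k. \<Sum>x\<in>P r. f x)" for f :: "'a \<Rightarrow> real"
    unfolding P_def by (rule sum_over_clusters[OF X(1) _ img]) simp
  have asgP: "asg t \<omega> x = r" if "x \<in> P r" for x r using that by (simp add: P_def cluster_def)
  have gap: "gap t \<omega> = (\<Sum>r<k. real (card (P r)) * (norm (u r))\<^sup>2)"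
    unfolding gap_def split
  proof (rule sum.cong)
    fix r
    have "(\<Sum>x\<in>P r. (norm (C t \<omega> (asg t \<omega> x) - centre X (asg t \<omega>) x))\<^sup>2) = (\<Sum>x\<in>P r. (norm (u r))\<^sup>2)"
      using asgP by (intro sum.cong) (auto simp: u_def centre_on_cluster P_def norm_minus_commute)
    then show "(\<Sum>x\<in>P r. (norm (C t \<omega> (asg t \<omega> x) - centre X (asg t \<omega>) x))\<^sup>2) = real (card (P r)) * (norm (u r))\<^sup>2"
      by simp
  qed simp
  have pull: "pull t \<omega> xs = (\<Sum>r<k. real (card (P r)) * (disp t \<omega> xs r \<bullet> u r))" for xs
    unfolding pull_def split
  proof (rule sum.cong)
    fix r
    have "(\<Sum>x\<in>P r. (x - C t \<omega> (asg t \<omega> x)) \<bullet> disp t \<omega> xs (asg t \<omega> x)) = (\<Sum>x\<in>P r. x - C t \<omega> r) \<bullet> disp t \<omega> xs r"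
      unfolding inner_sum_left using asgP by (intro sum.cong) auto
    then show "(\<Sum>x\<in>P r. (x - C t \<omega> (asg t \<omega> x)) \<bullet> disp t \<omega> xs (asg t \<omega> x)) = real (card (P r)) * (disp t \<omega> xs r \<bullet> u r)"
      unfolding sum_diff_const_mean[OF P(1)] by (simp add: u_def inner_commute)
  qed simp
  have "hit * gap t \<omega> = (\<Sum>r<k. real (card (P r)) * ((norm (u r))\<^sup>2 * hit))"
    unfolding gap sum_distrib_left by (simp add: mult_ac)
  also have "\<dots> \<le> (\<Sum>r<k. real (card (P r)) * ((norm (u r))\<^sup>2 * ((n ^ m - (n - real (card (P r))) ^ m) / n ^ m)))"
  proof (rule sum_mono)
    fix r
    show "real (card (P r)) * ((norm (u r))\<^sup>2 * hit)
        \<le> real (card (P r)) * ((norm (u r))\<^sup>2 * ((n ^ m - (n - real (card (P r))) ^ m) / n ^ m))"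
    proof (cases "card (P r) = 0")
      case False
      then have "1 \<le> real (card (P r))" by simp
      moreover have "real (card (P r)) \<le> n" unfolding n_def using card_mono[OF X(1) P(2)] by simp
      ultimately have "hit \<le> (n ^ m - (n - real (card (P r))) ^ m) / n ^ m"
        unfolding hit_def n_def[symmetric] by (rule prob_hit_ge)
      then show ?thesis by (intro mult_left_mono) auto
    qed simp
  qed
  also have "\<dots> = (\<Sum>r<k. real (card (P r)) * ((\<Sum>xs\<in>batches. disp t \<omega> xs r \<bullet> u r) / n ^ m))"
    unfolding disp_def u_def P_def n_def sum_displacement[OF X(1)] by simp
  also have "\<dots> = (\<Sum>xs\<in>batches. pull t \<omega> xs) / n ^ m"
    unfolding pull by (subst sum.swap) (simp add: sum_distrib_left sum_divide_distrib)
  finally show ?thesis by (simp add: n_def)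
qed

text \<open>The quadratic part is at most \<open>bound\<close> times the squared rate. In the linear
  part the batch is averaged out while \<open>w\<close>, the centroids and the assignment, all known
  at time \<open>t\<close>, stay fixed.\<close>

lemma expected_change:
  assumes w: "w \<in> borel_measurable (F t)" "\<And>\<omega>. \<omega> \<in> space M \<Longrightarrow> 0 \<le> w \<omega> \<and> w \<omega> \<le> W"
  shows "(\<integral>\<omega>. w \<omega> * change t \<omega> \<partial>M)
    \<le> (\<integral>\<omega>. w \<omega> * (bound * (h (Suc t))\<^sup>2 - 2 * hit * h (Suc t) * gap t \<omega>) \<partial>M)"
proof -
  let ?h = "h (Suc t)"
  let ?B = "real (card X) * (4 * \<rho>\<^sup>2)"
  have [measurable]: "w \<in> borel_measurable M" "gap t \<in> borel_measurable M" "change t \<in> borel_measurable M"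
    using measurable_from_subalg[OF subalg] w(1) gap_measurable change_measurable by blast+
  have pullM [measurable]: "(\<lambda>\<omega>. pull t \<omega> xs) \<in> borel_measurable M" for xs
    using measurable_from_subalg[OF subalg pull_measurable] .
  have pull_batch [measurable]: "(\<lambda>\<omega>. pull t \<omega> (batch t \<omega>)) \<in> borel_measurable M"
  proof (rule measurable_compose_countable'[where I = batches])
    show "batch t \<in> M \<rightarrow>\<^sub>M count_space batches" using measurable_from_subalg[OF subalg batch_measurable] .
  qed (use finite_batches pullM in \<open>auto intro: countable_finite\<close>)
  have mb: "\<bar>w \<omega> * y\<bar> \<le> W * b" if "\<omega> \<in> space M" "\<bar>y\<bar> \<le> b" for \<omega> y b
    using w(2)[OF that(1)] that(2) by (simp add: abs_mult mult_mono')
  have gap_bound: "\<bar>gap t \<omega>\<bar> \<le> real (card X) * (2 * \<rho>)\<^sup>2" if \<omega>: "\<omega> \<in> space M" for \<omega>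
  proof -
    have "gap t \<omega> \<le> cost t \<omega>"
      using cost_minus_gap[OF \<omega>, of t] sum_nonneg[of X "\<lambda>x. (norm (x - centre X (asg t \<omega>) x))\<^sup>2"] by simp
    also have "\<dots> \<le> (\<Sum>x\<in>X. (2 * \<rho>)\<^sup>2)"
      unfolding cost_eq[OF \<omega>] using dist_bound[OF \<omega>] by (intro sum_mono power_mono) auto
    finally show ?thesis using sum_nonneg[of X "\<lambda>x. (norm (C t \<omega> (asg t \<omega> x) - centre X (asg t \<omega>) x))\<^sup>2"] by (simp add: gap_def)
  qed
  have i1: "integrable M (\<lambda>\<omega>. w \<omega> * change t \<omega>)"
    by (rule integrable_const_bound[where B = "W * (bound * ?h)"]) (use mb change_abs in auto)
  have i2: "integrable M (\<lambda>\<omega>. w \<omega> * pull t \<omega> (batch t \<omega>))"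
    by (rule integrable_const_bound[where B = "W * ?B"]) (use mb pull_abs batch_in in auto)
  have i3: "integrable M w" by (rule integrable_const_bound[where B = W]) (use w(2) in auto)
  have i4: "integrable M (\<lambda>\<omega>. w \<omega> * gap t \<omega>)"
    by (rule integrable_const_bound[where B = "W * (real (card X) * (2 * \<rho>)\<^sup>2)"]) (use mb gap_bound in auto)
  have i5: "integrable M (\<lambda>\<omega>. w \<omega> * pull t \<omega> xs)" if "xs \<in> batches" for xs
    by (rule integrable_const_bound[where B = "W * ?B"]) (use mb pull_abs that in auto)
  have "(\<integral>\<omega>. w \<omega> * change t \<omega> \<partial>M) \<le> (\<integral>\<omega>. w \<omega> * (bound * ?h\<^sup>2) - 2 * ?h * (w \<omega> * pull t \<omega> (batch t \<omega>)) \<partial>M)"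
  proof (rule integral_mono)
    fix \<omega> assume \<omega>: "\<omega> \<in> space M"
    have "change t \<omega> = ?h\<^sup>2 * (\<Sum>x\<in>X. (norm (disp t \<omega> (batch t \<omega>) (asg t \<omega> x)))\<^sup>2) - 2 * ?h * pull t \<omega> (batch t \<omega>)"
      unfolding change_eq[OF \<omega>] pull_def by (simp add: sum_subtractf sum_distrib_left)
    also have "(\<Sum>x\<in>X. (norm (disp t \<omega> (batch t \<omega>) (asg t \<omega> x)))\<^sup>2) \<le> (\<Sum>x\<in>X. (2 * \<rho>)\<^sup>2)"
      using disp_bound[OF \<omega> asg_less[OF \<omega>] batch_in[OF \<omega>]] by (intro sum_mono power_mono) auto
    also have "\<dots> \<le> bound" by (simp add: bound_def power_mult_distrib)
    finally have "change t \<omega> \<le> ?h\<^sup>2 * bound - 2 * ?h * pull t \<omega> (batch t \<omega>)"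
      by (simp add: mult_left_mono)
    then have "w \<omega> * change t \<omega> \<le> w \<omega> * (?h\<^sup>2 * bound - 2 * ?h * pull t \<omega> (batch t \<omega>))"
      using w(2)[OF \<omega>] by (intro mult_left_mono) auto
    then show "w \<omega> * change t \<omega> \<le> w \<omega> * (bound * ?h\<^sup>2) - 2 * ?h * (w \<omega> * pull t \<omega> (batch t \<omega>))"
      by (simp add: algebra_simps)
  qed (use i1 i2 i3 in auto)
  also have "\<dots> = (\<integral>\<omega>. w \<omega> \<partial>M) * (bound * ?h\<^sup>2) - 2 * ?h * (\<integral>\<omega>. w \<omega> * pull t \<omega> (batch t \<omega>) \<partial>M)"
    using i2 i3 by simp
  also have "(\<integral>\<omega>. w \<omega> * pull t \<omega> (batch t \<omega>) \<partial>M) = (\<integral>\<omega>. (\<Sum>xs\<in>batches. w \<omega> * pull t \<omega> xs) / real (card X) ^ m \<partial>M)"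
  proof (rule integral_over_batch[where g = "\<lambda>\<omega> xs. w \<omega> * pull t \<omega> xs" and B = "W * ?B"])
    show "(\<lambda>\<omega>. w \<omega> * pull t \<omega> xs) \<in> borel_measurable (F t)" for xs
      using w(1) pull_measurable by (intro borel_measurable_times) auto
  qed (use mb pull_abs in auto)
  also have "(\<integral>\<omega>. w \<omega> \<partial>M) * (bound * ?h\<^sup>2) - 2 * ?h * \<dots>
      \<le> (\<integral>\<omega>. w \<omega> \<partial>M) * (bound * ?h\<^sup>2) - 2 * ?h * (\<integral>\<omega>. hit * (w \<omega> * gap t \<omega>) \<partial>M)"
  proof -
    have "(\<integral>\<omega>. hit * (w \<omega> * gap t \<omega>) \<partial>M) \<le> (\<integral>\<omega>. (\<Sum>xs\<in>batches. w \<omega> * pull t \<omega> xs) / real (card X) ^ m \<partial>M)"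
    proof (rule integral_mono)
      fix \<omega> assume \<omega>: "\<omega> \<in> space M"
      have "w \<omega> * (hit * gap t \<omega>) \<le> w \<omega> * ((\<Sum>xs\<in>batches. pull t \<omega> xs) / real (card X) ^ m)"
        using mean_pull[OF \<omega>] w(2)[OF \<omega>] by (intro mult_left_mono) auto
      then show "hit * (w \<omega> * gap t \<omega>) \<le> (\<Sum>xs\<in>batches. w \<omega> * pull t \<omega> xs) / real (card X) ^ m"
        by (simp add: sum_distrib_left mult_ac)
    qed (use i4 i5 in auto)
    then show ?thesis using h[of "Suc t"] by (intro diff_left_mono mult_left_mono) auto
  qed
  also have "\<dots> = (\<integral>\<omega>. w \<omega> * (bound * ?h\<^sup>2) - 2 * ?h * (hit * (w \<omega> * gap t \<omega>)) \<partial>M)"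
    using i3 i4 by simp
  also have "\<dots> = (\<integral>\<omega>. w \<omega> * (bound * ?h\<^sup>2 - 2 * hit * ?h * gap t \<omega>) \<partial>M)"
    by (rule Bochner_Integration.integral_cong) (auto simp: algebra_simps)
  finally show ?thesis .
qed

lemma kmeans_drift_process:
  assumes "\<epsilon> > 0"
    and lev: "\<And>c f. nearest X {..<k} c f \<Longrightarrow> (\<Sum>x\<in>X. (norm (c (f x) - centre X f x))\<^sup>2) < \<epsilon> \<Longrightarrow>
      (\<Sum>x\<in>X. (norm (x - centre X f x))\<^sup>2) \<in> L"
    and "finite L" and rate: "\<And>t. h t = c / (real t + q)" and c: "hit * c > 1" "c \<le> 1 + q"
  shows "drift_process M F cost gap change L \<epsilon> hit (real (card X) * (2 * \<rho>)\<^sup>2) bound c q (\<lambda>t. h (Suc t))"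
proof (intro drift_process.intro drift_process_axioms.intro)
  show "prob_space M" by (rule prob_space_axioms)
  show "filtration (space M) F" by (rule filtration_axioms)
  have nonneg: "0 \<le> gap t \<omega>" for t \<omega> by (simp add: gap_def sum_nonneg)
  fix t
  show "subalgebra M (F t)" by (rule subalg)
  show "cost t \<in> borel_measurable (F t)" by (rule cost_measurable)
  show "gap t \<in> borel_measurable (F t)" by (rule gap_measurable)
  show "change t \<in> borel_measurable M" by (rule change_measurable)
  show "h (Suc t) = c / (real t + 1 + q)" by (simp add: rate add_ac)
  {
    fix \<omega> assume \<omega>: "\<omega> \<in> space M"
    have cost_le: "cost t \<omega> \<le> real (card X) * (2 * \<rho>)\<^sup>2"
    proof -
      have "cost t \<omega> \<le> (\<Sum>x\<in>X. (2 * \<rho>)\<^sup>2)"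
        unfolding cost_eq[OF \<omega>] using dist_bound[OF \<omega>] by (intro sum_mono power_mono) auto
      then show ?thesis by simp
    qed
    have gap_le: "gap t \<omega> \<le> cost t \<omega>"
      using cost_minus_gap[OF \<omega>, of t] sum_nonneg[of X "\<lambda>x. (norm (x - centre X (asg t \<omega>) x))\<^sup>2"] by simp
    show "0 \<le> cost t \<omega> \<and> cost t \<omega> \<le> real (card X) * (2 * \<rho>)\<^sup>2" using cost_le gap_le nonneg[of t \<omega>] by simp
    show "0 \<le> gap t \<omega> \<and> gap t \<omega> \<le> real (card X) * (2 * \<rho>)\<^sup>2" using cost_le gap_le nonneg[of t \<omega>] by simp
    show "\<bar>change t \<omega>\<bar> \<le> bound * h (Suc t)" by (rule change_abs[OF \<omega>])
    \<comment> \<open>Pythagoras with the old clusters and the new centroids: no centroids do better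
      on these clusters than their means.\<close>
    have "(\<Sum>x\<in>X. (norm (x - centre X (asg t \<omega>) x))\<^sup>2) \<le> (\<Sum>x\<in>X. (norm (x - C (Suc t) \<omega> (asg t \<omega> x)))\<^sup>2)"
      by (subst pythagoras_clusters[OF X(1), of "C (Suc t) \<omega>"]) (simp add: sum_nonneg)
    then show "- gap t \<omega> \<le> change t \<omega>" using cost_minus_gap[OF \<omega>, of t] by (simp add: change_def)
    show "cost (Suc t) \<omega> \<le> cost t \<omega> + change t \<omega>"
      unfolding change_def using kcost_le_assigned[OF X(1), of "{..<k}" "asg t \<omega>" "C (Suc t) \<omega>"] asg_less[OF \<omega>]
      by (auto simp: cost_def)
    show "cost t \<omega> - gap t \<omega> \<in> L" if "gap t \<omega> < \<epsilon>"
      unfolding cost_minus_gap[OF \<omega>] using that asg_nearest[OF \<omega>, of t] by (intro lev) (auto simp: gap_def)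
  }
  show "(\<integral>\<omega>. w \<omega> * change t \<omega> \<partial>M) \<le> (\<integral>\<omega>. w \<omega> * (bound * (h (Suc t))\<^sup>2 - 2 * hit * h (Suc t) * gap t \<omega>) \<partial>M)"
    if "w \<in> borel_measurable (F t)" "\<And>\<omega>. \<omega> \<in> space M \<Longrightarrow> 0 \<le> w \<omega> \<and> w \<omega> \<le> W" for w W
    using that by (rule expected_change)
  have "real m / real (card X) > 0" using X m by (simp add: card_gt_0_iff)
  then show "hit > 0" "hit \<le> 1" by (auto simp: hit_def)
qed (use assms bound_pos in auto)

end

section \<open>Conditional expectations and the final estimate\<close>

lemma (in prob_space) integral_uniform_measure:
  fixes f :: "'a \<Rightarrow> real"
  assumes [measurable]: "f \<in> borel_measurable M" "A \<in> sets M" and A: "prob A > 0"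
  shows "(\<integral>\<omega>. f \<omega> \<partial>uniform_measure M A) = (\<integral>\<omega>. f \<omega> * indicator A \<omega> \<partial>M) / prob A"
proof -
  have "uniform_measure M A = density M (\<lambda>\<omega>. ennreal (indicator A \<omega> / prob A))"
    unfolding uniform_measure_def
  proof (intro density_cong AE_I2)
    show "indicator A \<omega> / emeasure M A = ennreal (indicator A \<omega> / prob A)" for \<omega>
      using divide_ennreal[of "indicator A \<omega>" "prob A"] A by (simp add: emeasure_eq_measure ennreal_indicator)
  qed measurable
  then have "(\<integral>\<omega>. f \<omega> \<partial>uniform_measure M A) = (\<integral>\<omega>. indicator A \<omega> / prob A * f \<omega> \<partial>M)"
    using A by (simp add: integral_real_density)
  also have "\<dots> = (\<integral>\<omega>. f \<omega> * indicator A \<omega> / prob A \<partial>M)" by (simp add: mult_ac)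
  finally show ?thesis by simp
qed

theorem theorem1:
  fixes X :: "'a::euclidean_space set" and n k m :: nat
    and r_min \<delta> c' t_o :: real
    and c0 :: "nat \<Rightarrow> 'a"
    and M :: "'w measure" and F :: "nat \<Rightarrow> 'w measure"
    and S :: "nat \<Rightarrow> nat \<Rightarrow> 'w \<Rightarrow> 'a"
    and a :: "nat \<Rightarrow> 'w \<Rightarrow> 'a \<Rightarrow> nat"
    and C :: "nat \<Rightarrow> 'w \<Rightarrow> nat \<Rightarrow> 'a"
  assumes "finite X" and "card X = n"
    and "k \<ge> 1" and "m \<ge> 1"
    and "phi_opt X k > 0"
    and "general_dataset X k"
    and "is_rmin X k r_min"
    and "0 < \<delta>" and "\<delta> < 1 / exp 1"
    and "inj_on c0 {..<k}" and "c0 ` {..<k} \<subseteq> convex hull X"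
    and "c' > max (phi_max X k / ((1 - exp (- real m / real n)) * r_min * phi_opt X k))
                  (1 / (1 - exp (- (4 * real m) / (5 * real n))))"
    and "t_o \<ge> 768 * c'\<^sup>2 * (1 + 1 / r_min)\<^sup>2 * (real n)\<^sup>2 * (ln (1 / \<delta>))\<^sup>2"
    and "stochastic_kmeans M F X k m (\<lambda>r t. c' / (real t + t_o)) c0 S a C"
  shows "\<exists>G. (\<forall>A\<in>stationary_clusterings X k. G A \<in> sets M)
           \<and> measure M (\<Union>A\<in>stationary_clusterings X k. G A) \<ge> 1 - \<delta>
           \<and> (\<forall>A\<in>stationary_clusterings X k. measure M (G A) > 0 \<longrightarrow>
                (\<exists>B. \<forall>t\<ge>1.
                   \<bar>\<integral>\<omega>. kcost X (C t \<omega> ` {..<k}) - kcost X (means A) \<partial>uniform_measure M (G A)\<bar>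
                     \<le> B / real t))"
proof -
  have n: "real n \<ge> 1"
  proof -
    have "c0 0 \<in> convex hull X" using assms(3,11) by auto
    then have "X \<noteq> {}" by auto
    then show ?thesis using assms(1,2) by (auto simp: Suc_le_eq card_gt_0_iff)
  qed
  then have X: "finite X" "X \<noteq> {}" using assms(1,2) by auto
  \<comment> \<open>The second entry of the maximum gives \<open>hit * c' > 1\<close>, since the
    exponent \<open>4 m / (5 n)\<close> is smaller than \<open>m / n\<close>.\<close>
  have c: "c' > 1 / (1 - exp (- (4 * real m) / (5 * real n)))" using assms(12) by simp
  have mn: "- real m / real n \<le> - (4 * real m) / (5 * real n)" "- (4 * real m) / (5 * real n) < 0"
    using n assms(4) by (auto simp: field_simps)
  then have hit0: "0 < 1 - exp (- (4 * real m) / (5 * real n))"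
    "1 - exp (- (4 * real m) / (5 * real n)) \<le> 1 - exp (- real m / real n)" by simp_all
  have c0: "c' > 0" using c hit0(1) by (meson less_trans zero_less_divide_1_iff)
  have "1 < (1 - exp (- (4 * real m) / (5 * real n))) * c'"
    using c hit0(1) by (simp add: field_simps)
  also have "\<dots> \<le> (1 - exp (- real m / real n)) * c'" using hit0(2) c0 by (intro mult_right_mono) auto
  finally have rate: "(1 - exp (- real m / real n)) * c' > 1" .
  have "(1 - exp (- real m / real n)) * c' \<le> 1 * c'" using c0 by (intro mult_right_mono) auto
  then have c1: "c' > 1" using rate by linarith
  \<comment> \<open>Keeps all rates at most 1. Here \<open>c' > 1\<close> gives
    \<open>c' \<le> c'\<^sup>2\<close>, and the remaining factors are at least 1; for the logarithm
    this is \<open>\<delta> < 1 / exp 1\<close>.\<close>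
  have t_o: "c' \<le> t_o"
  proof -
    have "exp 1 < 1 / \<delta>" using assms(8,9) by (simp add: field_simps)
    then have "1 \<le> ln (1 / \<delta>)" using assms(8) by (subst ln_ge_iff) auto
    moreover have "1 \<le> 1 + 1 / r_min" using assms(7) by (simp add: is_rmin_def)
    ultimately have sq: "1 \<le> (ln (1 / \<delta>))\<^sup>2" "1 \<le> (1 + 1 / r_min)\<^sup>2" "1 \<le> (real n)\<^sup>2"
      using n by (simp_all add: one_le_power)
    have "c' * 1 * 1 * 1 \<le> (768 * c'\<^sup>2) * (1 + 1 / r_min)\<^sup>2 * (real n)\<^sup>2 * (ln (1 / \<delta>))\<^sup>2"
    proof (intro mult_mono sq)
      have "c' * 1 \<le> c' * c'" using c1 by (intro mult_left_mono) auto
      then show "c' \<le> 768 * c'\<^sup>2" using zero_le_power2[of c'] unfolding power2_eq_square by linarith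
    qed (use c1 in auto)
    then show ?thesis using assms(13) by simp
  qed
  obtain \<rho> where \<rho>: "\<rho> > 0" "X \<subseteq> cball 0 \<rho>"
    using finite_imp_bounded[OF X(1)] by (meson bounded_subset_ballD ball_subset_cball order_trans)
  have hull: "norm (c0 r) \<le> \<rho>" if "r < k" for r
  proof -
    have "convex hull X \<subseteq> cball 0 \<rho>" using \<rho>(2) by (intro hull_minimal) auto
    then show ?thesis using assms(11) that by fastforce
  qed
  interpret kmeans_run M F X k m "\<lambda>t. c' / (real t + t_o)" c0 S a C \<rho>
  proof (intro kmeans_run.intro kmeans_run_axioms.intro)
    show "stochastic_kmeans M F X k m (\<lambda>r t. c' / (real t + t_o)) c0 S a C" by (rule assms(14))
    show "norm x \<le> \<rho>" if "x \<in> X" for x using \<rho>(2) that by auto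
    show "0 < c' / (real t + t_o)" "c' / (real t + t_o) \<le> 1" for t using c1 t_o by auto
    show "1 \<le> m" by (rule assms(4))
  qed (fact X \<rho>(1) | rule hull)+
  define L where "L = (\<lambda>A. kcost X (means A)) ` stationary_clusterings X k"
  obtain \<epsilon> where \<epsilon>: "\<epsilon> > 0"
    "\<And>c f. nearest X {..<k} c f \<Longrightarrow> (\<Sum>x\<in>X. (norm (c (f x) - centre X f x))\<^sup>2) < \<epsilon> \<Longrightarrow>
      \<exists>A\<in>stationary_clusterings X k. kcost X (means A) = (\<Sum>x\<in>X. (norm (x - centre X f x))\<^sup>2)"
    by (rule stationary_if_near_centres[OF X, of k]) blast
  interpret drift_process M F cost gap change L \<epsilon> hit "real (card X) * (2 * \<rho>)\<^sup>2" bound c' t_o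
    "\<lambda>t. c' / (real (Suc t) + t_o)"
  proof (rule kmeans_drift_process)
    show "(\<Sum>x\<in>X. (norm (x - centre X f x))\<^sup>2) \<in> L"
      if "nearest X {..<k} c f" "(\<Sum>x\<in>X. (norm (c (f x) - centre X f x))\<^sup>2) < \<epsilon>" for c f
      using \<epsilon>(2)[OF that] unfolding L_def by (metis image_eqI)
    show "finite L" unfolding L_def using finite_stationary_clusterings[OF X(1)] by simp
    show "hit * c' > 1" using rate by (simp add: hit_def assms(2))
  qed (use \<epsilon>(1) t_o in auto)
  obtain G where G: "\<forall>l\<in>L. G l \<in> sets M" "prob (\<Union>l\<in>L. G l) \<ge> 1 - \<delta>"
    "\<forall>l\<in>L. \<exists>B. \<forall>t\<ge>1. (\<integral>\<omega>. \<bar>cost t \<omega> - l\<bar> * indicator (G l) \<omega> \<partial>M) \<le> B / real t"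
    using convergence_to_levels[OF assms(8)] by (elim exE conjE)
  have bound: "\<exists>B. \<forall>t\<ge>1. \<bar>\<integral>\<omega>. cost t \<omega> - l \<partial>uniform_measure M (G l)\<bar> \<le> B / real t"
    if l: "l \<in> L" and p: "prob (G l) > 0" for l
  proof -
    obtain B where B: "\<And>t. t \<ge> 1 \<Longrightarrow> (\<integral>\<omega>. \<bar>cost t \<omega> - l\<bar> * indicator (G l) \<omega> \<partial>M) \<le> B / real t"
      using bspec[OF G(3) l] by (elim exE) blast
    have "\<bar>\<integral>\<omega>. cost t \<omega> - l \<partial>uniform_measure M (G l)\<bar> \<le> B / prob (G l) / real t" if t: "t \<ge> 1" for t
    proof -
      have "\<bar>\<integral>\<omega>. (cost t \<omega> - l) * indicator (G l) \<omega> \<partial>M\<bar> \<le> (\<integral>\<omega>. \<bar>(cost t \<omega> - l) * indicator (G l) \<omega>\<bar> \<partial>M)"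
        by (rule integral_abs_bound)
      also have "\<dots> = (\<integral>\<omega>. \<bar>cost t \<omega> - l\<bar> * indicator (G l) \<omega> \<partial>M)"
        by (rule Bochner_Integration.integral_cong) (auto simp: abs_mult)
      also have "\<dots> \<le> B / real t" by (rule B[OF t])
      finally have "\<bar>\<integral>\<omega>. (cost t \<omega> - l) * indicator (G l) \<omega> \<partial>M\<bar> / prob (G l) \<le> B / real t / prob (G l)"
        using p by (intro divide_right_mono) auto
      then show ?thesis
        using p Y_meas_M[of t] bspec[OF G(1) l] by (simp add: integral_uniform_measure abs_divide mult.commute)
    qed
    then show ?thesis by blast
  qed
  \<comment> \<open>A clustering receives the event of its cost level, so the union over clusterings
    is the union over levels.\<close>
  show ?thesis
  proof (intro exI[of _ "\<lambda>A. G (kcost X (means A))"] conjI ballI impI)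
    show "G (kcost X (means A)) \<in> sets M" if "A \<in> stationary_clusterings X k" for A
      using that G(1) by (simp add: L_def)
    have "(\<Union>A\<in>stationary_clusterings X k. G (kcost X (means A))) = (\<Union>l\<in>L. G l)" by (simp add: L_def)
    then show "measure M (\<Union>A\<in>stationary_clusterings X k. G (kcost X (means A))) \<ge> 1 - \<delta>" using G(2) by simp
    fix A assume "A \<in> stationary_clusterings X k" "measure M (G (kcost X (means A))) > 0"
    then show "\<exists>B. \<forall>t\<ge>1. \<bar>\<integral>\<omega>. kcost X (C t \<omega> ` {..<k}) - kcost X (means A)
        \<partial>uniform_measure M (G (kcost X (means A)))\<bar> \<le> B / real t"
      using bound[of "kcost X (means A)"] by (simp add: L_def cost_def)
  qed
qed

end
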